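(* Let $\mathbb{E}\subset\mathbb{C}^3$ be the tetrablock, i.e. $\mathbb{E}=\varphi(\mathcal{R}_{II})$, where $\mathcal{R}_{II}$ is the set of all $(z_{11},z_{22},z)\in\mathbb{C}^3$ such that the symmetric matrix $\begin{pmatrix} z_{11}&z\\ z&z_{22}\end{pmatrix}$ has operator norm smaller than $1$, and $\varphi(z_{11},z_{22},z)=(z_{11},z_{22},z_{11}z_{22}-z^2)$. Then $\mathbb{E}$ is not a Lu Qi-Keng domain.
   Context: For a domain $\Omega\subset\mathbb{C}^n$, the Bergman kernel $K_\Omega:\Omega\times\Omega\to\mathbb{C}$ is the reproducing kernel of the Hilbert space $\mathbb{A}^2(\Omega)$ of holomorphic functions on $\Omega$ that are square integrable with respect to Lebesgue measure: $f(\zeta)=\langle f,K_\Omega(\cdot,\zeta)\rangle$ for all $f\in\mathbb{A}^2(\Omega)$ and $\zeta\in\Omega$. The domain $\Omega$ is a Lu Qi-Keng domain if $K_\Omega$ has no zeros in $\Omega\times\Omega$, and is not a Lu Qi-Keng domain if $K_\Omega$ has a zero there. The set $\mathbb{E}$ is a domain in $\mathbb{C}^3$. *)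

theory Defs
  imports "HOL-Analysis.Analysis"
begin

definition holomorphic_on_vec :: "(complex ^ 'n \<Rightarrow> complex) \<Rightarrow> (complex ^ 'n) set \<Rightarrow> bool"
  where "holomorphic_on_vec f \<Omega> \<longleftrightarrow>
    (\<forall>z\<in>\<Omega>. \<exists>D. (f has_derivative D) (at z) \<and> (\<forall>c v. D (c *s v) = c * D v))"

definition bergman_space :: "(complex ^ 'n) set \<Rightarrow> (complex ^ 'n \<Rightarrow> complex) set"
  where "bergman_space \<Omega> =
    {f. holomorphic_on_vec f \<Omega> \<and> set_integrable lborel \<Omega> (\<lambda>z. (norm (f z))\<^sup>2)}"

definition bergman_inner ::
  "(complex ^ 'n) set \<Rightarrow> (complex ^ 'n \<Rightarrow> complex) \<Rightarrow> (complex ^ 'n \<Rightarrow> complex) \<Rightarrow> complex"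
  where "bergman_inner \<Omega> f g = (LINT z:\<Omega>|lborel. f z * cnj (g z))"

definition is_bergman_kernel ::
  "(complex ^ 'n) set \<Rightarrow> (complex ^ 'n \<Rightarrow> complex ^ 'n \<Rightarrow> complex) \<Rightarrow> bool"
  where "is_bergman_kernel \<Omega> K \<longleftrightarrow>
    (\<forall>\<zeta>\<in>\<Omega>. (\<lambda>z. K z \<zeta>) \<in> bergman_space \<Omega> \<and>
      (\<forall>f\<in>bergman_space \<Omega>. f \<zeta> = bergman_inner \<Omega> f (\<lambda>z. K z \<zeta>)))"

lemma is_bergman_kernel_unique:
  fixes \<Omega> :: "(complex ^ 'n) set"
  assumes K: "is_bergman_kernel \<Omega> K" and L: "is_bergman_kernel \<Omega> L"
    and z: "z \<in> \<Omega>" and w: "w \<in> \<Omega>"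
  shows "K z w = L z w"
proof -
  have swap: "bergman_inner \<Omega> g f = cnj (bergman_inner \<Omega> f g)" for f g :: "complex ^ 'n \<Rightarrow> complex"
    unfolding bergman_inner_def set_lebesgue_integral_def Bochner_Integration.integral_cnj[symmetric]
    by (simp add: mult.commute)
  have mem: "(\<lambda>v. M v \<zeta>) \<in> bergman_space \<Omega>"
    and rep: "\<And>f. f \<in> bergman_space \<Omega> \<Longrightarrow> f \<zeta> = bergman_inner \<Omega> f (\<lambda>v. M v \<zeta>)"
    if "is_bergman_kernel \<Omega> M" "\<zeta> \<in> \<Omega>" for M \<zeta>
    using that unfolding is_bergman_kernel_def by blast+
  have "K z w = bergman_inner \<Omega> (\<lambda>v. K v w) (\<lambda>v. L v z)"
    by (rule rep[OF L z mem[OF K w]])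
  also have "\<dots> = cnj (bergman_inner \<Omega> (\<lambda>v. L v z) (\<lambda>v. K v w))"
    by (rule swap)
  also have "\<dots> = cnj (L w z)"
    by (simp add: rep[OF K w mem[OF L z], symmetric])
  also have "L w z = bergman_inner \<Omega> (\<lambda>v. L v z) (\<lambda>v. L v w)"
    by (rule rep[OF L w mem[OF L z]])
  also have "cnj \<dots> = bergman_inner \<Omega> (\<lambda>v. L v w) (\<lambda>v. L v z)"
    by (rule swap[symmetric])
  also have "\<dots> = L z w"
    by (rule rep[OF L z mem[OF L w], symmetric])
  finally show ?thesis .
qed

text \<open>The reproducing property determines the kernel only on \<open>\<Omega> \<times> \<Omega>\<close>; the kernel is extended
  by zero to the whole type so that the description is unique.\<close>

definition bergman_kernel :: "(complex ^ 'n) set \<Rightarrow> complex ^ 'n \<Rightarrow> complex ^ 'n \<Rightarrow> complex"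
  where "bergman_kernel \<Omega> =
    (THE K. is_bergman_kernel \<Omega> K \<and> (\<forall>z w. z \<notin> \<Omega> \<or> w \<notin> \<Omega> \<longrightarrow> K z w = 0))"

text \<open>Intended for domains \<open>\<Omega>\<close>; that \<open>\<Omega>\<close> is a domain is not part of the predicate, so its negation
  says precisely that the kernel has a zero in \<open>\<Omega> \<times> \<Omega>\<close>.\<close>

definition lu_qi_keng :: "(complex ^ 'n) set \<Rightarrow> bool"
  where "lu_qi_keng \<Omega> \<longleftrightarrow> (\<forall>z\<in>\<Omega>. \<forall>w\<in>\<Omega>. bergman_kernel \<Omega> z w \<noteq> 0)"

text \<open>A point of \<open>complex ^ 3\<close> is read as \<open>(z\<^sub>1\<^sub>1, z\<^sub>2\<^sub>2, z)\<close>.\<close>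

definition sym_matrix :: "complex ^ 3 \<Rightarrow> complex ^ 2 ^ 2"
  where "sym_matrix x = vector [vector [x $ 1, x $ 3], vector [x $ 3, x $ 2]]"

definition R_II :: "(complex ^ 3) set"
  where "R_II = {x. onorm (\<lambda>v. sym_matrix x *v v) < 1}"

definition tetrablock_map :: "complex ^ 3 \<Rightarrow> complex ^ 3"
  where "tetrablock_map x = vector [x $ 1, x $ 2, x $ 1 * x $ 2 - (x $ 3)\<^sup>2]"

definition tetrablock :: "(complex ^ 3) set"
  where "tetrablock = tetrablock_map ` R_II"

end

theory Submission
  imports Defs "HOL-Complex_Analysis.Complex_Analysis"
begin

text \<open>The map \<open>\<phi>(z\<^sub>1\<^sub>1, z\<^sub>2\<^sub>2, z) = (z\<^sub>1\<^sub>1, z\<^sub>2\<^sub>2, z\<^sub>1\<^sub>1 z\<^sub>2\<^sub>2 - z\<^sup>2)\<close> is a branched double cover of the tetrablock \<open>E\<close> by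
  \<open>R_II\<close> with complex Jacobian \<open>- 2 z\<close>, so \<open>f \<mapsto> 2 z (f \<circ> \<phi>)\<close> identifies the Bergman space of \<open>E\<close>, up to a
  factor in the norm, with the functions in the Bergman space of \<open>R_II\<close> that are odd in \<open>z\<close>. The kernel
  of \<open>R_II\<close> at \<open>(0, 0, w)\<close> is a multiple of \<open>det(1 - Z W\<^sup>*)\<^sup>-\<^sup>3\<close>: a Moebius transformation of the matrix moves \<open>0\<close> to
  this point, and at \<open>0\<close> the mean value property of circular domains applies. Taking the odd part, the
  kernel of \<open>E\<close> at \<open>x\<close> and \<open>y = (0, 0, - w\<^sup>2)\<close> is a multiple of \<open>(3 A\<^sup>2 + B\<^sup>2) / (A\<^sup>2 - B\<^sup>2)\<^sup>3\<close> with
  \<open>A = 1 - w\<^sup>2 x\<^sub>3\<close> and \<open>B\<^sup>2 = 4 w\<^sup>2 (x\<^sub>1 x\<^sub>2 - x\<^sub>3)\<close>. At \<open>x = (0, 0, 1/\<surd>3)\<close>, \<open>y = (0, 0, - 1/\<surd>3)\<close> this vanishes.\<close>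

subsection \<open>Isometries and the mean value property of circular domains\<close>

text \<open>Since \<open>bergman_kernel\<close> is a definite description, a formula for one second
  argument says something about it only once a kernel on the whole tetrablock is known to exist.
  Existence is therefore proved for every open set, by minimizing the norm. Jacobians in six real
  variables are avoided: the two nonlinear changes of variables, matrix inversion and the double
  cover, are broken into substitutions in one complex variable, where the real Jacobian is the
  squared modulus of the derivative. Linear isometries carry \<open>lborel\<close> between the types
  involved. The point \<open>(0, 0, w)\<close> with real \<open>w\<close> is convenient because a
  permutation matrix turns it into \<open>w\<close> times the identity. All matrices in the Moebius
  formula then commute, so the map acts on eigenvalues and is an inversion between two affine maps.
  The constant: for x = (0, 0, s), y = (0, 0, -s) and w^2 = s the numerator is 3 (1 - s^2)^2 - 4 s^2
  = (3 s^2 - 1) (s^2 - 3), whose only root with 0 < s < 1 is s = 1/sqrt 3.\<close>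

lemma translation_invariant_measure_swap:
  fixes M N :: "'a::euclidean_space measure"
  assumes [simp]: "sets M = sets borel" "sets N = sets borel"
    and sf: "sigma_finite_measure M" "sigma_finite_measure N"
    and M: "\<And>t. distr M borel (\<lambda>x. t + x) = M" and N: "\<And>t. distr N borel (\<lambda>x. t + x) = N"
    and sym: "distr N borel uminus = N"
    and A: "A \<in> sets borel" and B: "B \<in> sets borel"
  shows "emeasure M A * emeasure N B = emeasure M B * emeasure N A"
proof -
  interpret M: sigma_finite_measure M by fact
  interpret N: sigma_finite_measure N by fact
  interpret pair_sigma_finite M N ..
  have [measurable_cong]: "sets M = sets borel" "sets N = sets borel" by simp_all
  note [measurable] = A B
  have N': "(\<integral>\<^sup>+y. f (t + y) \<partial>N) = (\<integral>\<^sup>+y. f y \<partial>N)" if [measurable]: "f \<in> borel_measurable borel"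
    for f t
  proof -
    have "(\<integral>\<^sup>+y. f y \<partial>N) = (\<integral>\<^sup>+y. f y \<partial>distr N borel (\<lambda>x. t + x))" by (simp only: N)
    then show ?thesis by (simp add: nn_integral_distr)
  qed
  have M': "(\<integral>\<^sup>+x. f (t + x) \<partial>M) = (\<integral>\<^sup>+x. f x \<partial>M)" if [measurable]: "f \<in> borel_measurable borel"
    for f t
  proof -
    have "(\<integral>\<^sup>+y. f y \<partial>M) = (\<integral>\<^sup>+y. f y \<partial>distr M borel (\<lambda>x. t + x))" by (simp only: M)
    then show ?thesis by (simp add: nn_integral_distr)
  qed
  have S: "(\<integral>\<^sup>+y. f (- y) \<partial>N) = (\<integral>\<^sup>+y. f y \<partial>N)" if [measurable]: "f \<in> borel_measurable borel" for f
  proof -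
    have "(\<integral>\<^sup>+y. f y \<partial>N) = (\<integral>\<^sup>+y. f y \<partial>distr N borel uminus)" by (simp only: sym)
    then show ?thesis by (simp add: nn_integral_distr)
  qed
  \<comment> \<open>This is the uniqueness of invariant measures up to a factor. Shifting
    \<open>y\<close> by \<open>x\<close>, then \<open>x\<close> by \<open>- y\<close>, and finally
    reflecting \<open>y\<close>, Tonelli trades the shift inside \<open>B\<close> for one inside
    \<open>A\<close>, so that the two sets exchange measures.\<close>
  have "emeasure M A * emeasure N B = (\<integral>\<^sup>+x. indicator A x * (\<integral>\<^sup>+y. indicator B y \<partial>N) \<partial>M)"
    by (simp add: nn_integral_multc)
  also have "\<dots> = (\<integral>\<^sup>+x. indicator A x * (\<integral>\<^sup>+y. indicator B (x + y) \<partial>N) \<partial>M)"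
    by (subst N') auto
  also have "\<dots> = (\<integral>\<^sup>+x. (\<integral>\<^sup>+y. indicator A x * indicator B (x + y) \<partial>N) \<partial>M)"
    by (subst nn_integral_cmult) auto
  also have "\<dots> = (\<integral>\<^sup>+y. (\<integral>\<^sup>+x. indicator A x * indicator B (x + y) \<partial>M) \<partial>N)"
    by (rule Fubini'[symmetric]) auto
  also have "\<dots> = (\<integral>\<^sup>+y. (\<integral>\<^sup>+x. indicator A (- y + x) * indicator B (- y + x + y) \<partial>M) \<partial>N)"
    by (subst M'[where t="- y" for y]) auto
  also have "\<dots> = (\<integral>\<^sup>+y. (\<integral>\<^sup>+x. indicator A (x - y) * indicator B x \<partial>M) \<partial>N)"
    by simp
  also have "\<dots> = (\<integral>\<^sup>+x. (\<integral>\<^sup>+y. indicator A (x - y) * indicator B x \<partial>N) \<partial>M)"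
    by (rule Fubini') auto
  also have "\<dots> = (\<integral>\<^sup>+x. (\<integral>\<^sup>+y. indicator A (x + - y) \<partial>N) * indicator B x \<partial>M)"
    by (subst nn_integral_multc) auto
  also have "\<dots> = (\<integral>\<^sup>+x. (\<integral>\<^sup>+y. indicator A (x + y) \<partial>N) * indicator B x \<partial>M)"
    by (subst S[where f = "\<lambda>y. indicator A (x + y)" for x]) auto
  also have "\<dots> = (\<integral>\<^sup>+x. (\<integral>\<^sup>+y. indicator A y \<partial>N) * indicator B x \<partial>M)"
    by (subst N') auto
  also have "\<dots> = (\<integral>\<^sup>+x. emeasure N A * indicator B x \<partial>M)"
    by (simp add: mult.commute)
  also have "\<dots> = emeasure M B * emeasure N A"
    by (subst nn_integral_cmult_indicator) (auto simp: mult.commute)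
  finally show ?thesis .
qed

lemma lborel_reflect: "distr lborel borel uminus = (lborel :: 'a::euclidean_space measure)"
  by (subst (2) lborel_affine[of "-1" 0]) (auto simp: density_1)

text \<open>The two types may differ, so the argument uses no determinant: the image measure is
  translation invariant because \<open>h\<close> is onto, hence proportional to
  \<open>lborel\<close>, and it agrees with \<open>lborel\<close> on the unit ball.\<close>

lemma lborel_distr_linear_isometry:
  fixes h :: "'a::euclidean_space \<Rightarrow> 'b::euclidean_space"
  assumes lin: "linear h" and nrm: "\<And>x. norm (h x) = norm x" and dim: "DIM('a) = DIM('b)"
  shows "distr lborel borel h = lborel"
proof -
  let ?M = "distr lborel borel h"
  interpret h: linear h by fact
  have hm[measurable]: "h \<in> borel_measurable borel"
    by (intro borel_measurable_continuous_onI linear_continuous_on linear_conv_bounded_linear[THEN iffD1] lin)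
  have inj: "inj h"
    unfolding h.inj_iff_eq_0 by (metis nrm norm_eq_zero)
  have "dim (range h) = DIM('b)"
    using dim_image_eq[OF lin, of UNIV] inj dim by simp
  then have surj: "surj h"
    by (metis dim_eq_full lin linear_subspace_image span_eq_iff subspace_UNIV)
  have vimage: "h -` ball 0 r = ball 0 r" for r
    by (auto simp: nrm)
  have ball: "emeasure ?M (ball 0 r) = emeasure lborel (ball (0::'b) r)" if "r \<ge> 0" for r
    using that by (simp add: emeasure_distr vimage emeasure_ball dim)
  have sf: "sigma_finite_measure ?M"
  proof
    show "\<exists>A. countable A \<and> A \<subseteq> sets ?M \<and> \<Union>A = space ?M \<and> (\<forall>a\<in>A. emeasure ?M a \<noteq> \<infinity>)"
    proof (intro exI conjI)
      show "\<Union>(range (\<lambda>n. ball (0::'b) (real n))) = space ?M"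
        using reals_Archimedean2 by auto
    qed (auto simp: ball emeasure_ball ennreal_mult_less_top)
  qed
  show ?thesis
  proof (rule measure_eqI)
    fix A assume "A \<in> sets ?M"
    then have A: "A \<in> sets borel" by simp
    have "emeasure ?M A * emeasure lborel (ball (0::'b) 1) = emeasure ?M (ball 0 1) * emeasure lborel A"
    proof (rule translation_invariant_measure_swap)
      fix t :: 'b
      obtain s where s: "h s = t" using surj by (metis surjD)
      have "distr ?M borel ((+) t) = distr lborel borel (\<lambda>x. h (s + x))"
        by (subst distr_distr) (auto simp: o_def h.add s)
      also have "\<dots> = distr (distr lborel borel ((+) s)) borel h"
        by (subst distr_distr) (auto simp: o_def)
      finally show "distr ?M borel ((+) t) = ?M"
        by (simp only: lborel_distr_plus)
    qed (use sf A lborel.sigma_finite_measure_axioms in \<open>auto simp: lborel_distr_plus lborel_reflect\<close>)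
    moreover have "emeasure lborel (ball (0::'b) 1) \<noteq> 0" "emeasure lborel (ball (0::'b) 1) \<noteq> \<infinity>"
      using unit_ball_vol_pos[of "real DIM('b)"] by (simp_all add: less_imp_neq[symmetric] emeasure_ball)
    ultimately show "emeasure ?M A = emeasure lborel A"
      by (simp add: ball mult.commute[of "emeasure ?M A"] ennreal_mult_cancel_left)
  qed simp
qed

lemma lborel_distr_rotation:
  assumes "cmod c = 1"
  shows "distr lborel borel ((*s) c) = (lborel :: (complex ^ 'n) measure)"
proof (rule lborel_distr_linear_isometry)
  show "linear ((*s) c :: complex ^ 'n \<Rightarrow> _)"
    by (rule linearI) (auto simp: vec_eq_iff algebra_simps)
  show "norm (c *s x) = norm x" for x :: "complex ^ 'n"
    using assms by (simp add: norm_vec_def norm_mult)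
qed simp

lemma continuous_smult_vec [continuous_intros]:
  fixes g :: "'a::topological_space \<Rightarrow> complex ^ 'n"
  assumes "continuous_on S f" "continuous_on S g"
  shows "continuous_on S (\<lambda>x. f x *s g x)"
  unfolding vector_scalar_mult_def by (intro continuous_intros assms)

text \<open>Rotations preserve both \<open>lborel\<close> and \<open>S\<close>, so the integral may
  be averaged over the unit circle. After Fubini the average for fixed \<open>v\<close> is the
  circle mean of c \<mapsto> G (c v), which is \<open>G 0\<close> by Cauchy's formula; the closed
  unit disc is mapped into \<open>S\<close>, so this function is continuous up to the
  boundary.\<close>

lemma circular_mean_value:
  fixes G :: "complex ^ 'n \<Rightarrow> complex"
  assumes S: "open S" and circ: "\<And>v c. v \<in> S \<Longrightarrow> cmod c \<le> 1 \<Longrightarrow> c *s v \<in> S"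
    and cont: "continuous_on S G"
    and hol: "\<And>v. v \<in> S \<Longrightarrow> (\<lambda>c. G (c *s v)) holomorphic_on ball 0 1"
    and int: "set_integrable lborel S G"
  shows "(LINT z:S|lborel. G z) = measure lborel S * G 0"
proof -
  define H where "H v = indicator S v *\<^sub>R G v" for v
  have Hm [measurable]: "H \<in> borel_measurable borel"
    unfolding H_def using S cont by (intro borel_measurable_continuous_on_indicator) auto
  have Hi: "integrable lborel H"
    using int by (simp add: H_def[abs_def] set_integrable_def)
  define e where "e t = exp (2 * of_real pi * \<i> * of_real t)" for t :: real
  have e [simp]: "cmod (e t) = 1" for t
    by (simp add: e_def norm_exp_eq_Re)
  have econt: "continuous_on A e" for A
    unfolding e_def by (intro continuous_intros)
  have HS: "H (e t *s v) = indicator S v *\<^sub>R G (e t *s v)" for t v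
  proof -
    have "v \<in> S" if "e t *s v \<in> S"
      using circ[OF that, of "inverse (e t)"] by (simp add: norm_inverse vector_smult_assoc e_def)
    then show ?thesis
      using circ[of v "e t"] by (auto simp: H_def indicator_def)
  qed
  define f where "f t v = indicator {0..1::real} t *\<^sub>R H (e t *s v)" for t v
  have fm [measurable]: "case_prod f \<in> borel_measurable (lborel \<Otimes>\<^sub>M lborel)"
  proof -
    have [measurable]: "(\<lambda>(t, v). e t *s v :: complex ^ 'n) \<in> borel_measurable (borel \<Otimes>\<^sub>M borel)"
      unfolding borel_prod case_prod_unfold
      by (intro borel_measurable_continuous_onI continuous_intros
          continuous_on_compose2[OF econt]) auto
    show ?thesis unfolding f_def by measurable
  qed
  have rot: "integrable lborel (\<lambda>v. F (e t *s v))" "(LINT v|lborel. F (e t *s v)) = (LINT v|lborel. F v)"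
    if F: "integrable lborel F" for t and F :: "complex ^ 'n \<Rightarrow> 'b::{banach, second_countable_topology}"
  proof -
    have [measurable]: "F \<in> borel_measurable borel" using F by auto
    have [measurable]: "(*s) (e t) \<in> borel_measurable (borel :: (complex ^ 'n) measure)"
      by (intro borel_measurable_continuous_onI continuous_intros)
    show "integrable lborel (\<lambda>v. F (e t *s v))"
      using F integrable_distr_eq[of "(*s) (e t)" lborel borel F]
      by (simp add: lborel_distr_rotation)
    show "(LINT v|lborel. F (e t *s v)) = (LINT v|lborel. F v)"
      using integral_distr[of "(*s) (e t)" lborel borel F] by (simp add: lborel_distr_rotation)
  qed
  have "integrable (lborel \<Otimes>\<^sub>M lborel) (case_prod f)"
  proof (rule lborel_pair.Fubini_integrable)
    have "(\<lambda>t. LINT v|lborel. norm (f t v)) = (\<lambda>t. indicator {0..1} t * (LINT v|lborel. norm (H v)))"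
      using rot(2)[of "\<lambda>v. norm (H v)"] Hi by (auto simp: f_def fun_eq_iff)
    then show "integrable lborel (\<lambda>t. LINT v|lborel. norm (case (t, v) of (t, v) \<Rightarrow> f t v))"
      by simp
    show "AE t in lborel. integrable lborel (\<lambda>v. case (t, v) of (t, v) \<Rightarrow> f t v)"
      using rot(1)[OF Hi] by (auto simp: f_def)
  qed (fact fm)
  then have "(LINT v|lborel. LINT t|lborel. f t v) = (LINT t|lborel. LINT v|lborel. f t v)"
    by (rule lborel_pair.Fubini_integral)
  also have "\<dots> = (LINT t|lborel. indicator {0..1::real} t *\<^sub>R (LINT v|lborel. H v))"
    using rot(2)[OF Hi] by (simp add: f_def)
  finally have swap: "(LINT v|lborel. LINT t|lborel. f t v) = (LINT v|lborel. H v)" by simp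
  have inner: "(LINT t|lborel. f t v) = indicator S v *\<^sub>R G 0" for v
  proof (cases "v \<in> S")
    case True
    define g where "g c = G (c *s v)" for c
    have hg: "g holomorphic_on ball 0 1" unfolding g_def using hol True by auto
    have cg: "continuous_on (cball 0 1) g"
      unfolding g_def by (rule continuous_on_compose2[OF cont]) (use circ[OF True] in \<open>auto intro!: continuous_intros\<close>)
    have "((\<lambda>u. g u / (u - 0)) has_contour_integral (2 * of_real pi * \<i> * g 0)) (circlepath 0 1)"
      using Cauchy_integral_circlepath[OF cg hg, of 0] by simp
    then have "((\<lambda>t. g (e t) / e t * (2 * of_real pi * \<i> * e t)) has_integral (2 * of_real pi * \<i> * g 0)) {0..1}"
      unfolding has_contour_integral_def
      by (rule has_integral_cong[THEN iffD1, rotated])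
        (simp add: vector_derivative_circlepath01 e_def, simp add: circlepath)
    then have "((\<lambda>t. (1 / (2 * of_real pi * \<i>)) * (g (e t) / e t * (2 * of_real pi * \<i> * e t)))
        has_integral ((1 / (2 * of_real pi * \<i>)) * (2 * of_real pi * \<i> * g 0))) {0..1}"
      by (rule has_integral_mult_right)
    moreover have "e t \<noteq> 0" for t by (simp add: e_def)
    ultimately have hi: "((\<lambda>t. g (e t)) has_integral g 0) {0..1}"
      by (simp add: field_simps)
    have "continuous_on {0..1} (\<lambda>t. g (e t))"
      by (rule continuous_on_compose2[OF cg econt]) auto
    then have "set_integrable lborel {0..1} (\<lambda>t. g (e t))"
      by (rule borel_integrable_atLeastAtMost')
    then have "(LINT t:{0..1}|lborel. g (e t)) = g 0"
      using hi by (simp add: set_borel_integral_eq_integral integral_unique)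
    then show ?thesis
      using True by (simp add: f_def HS set_lebesgue_integral_def g_def)
  qed (simp add: f_def HS)
  show ?thesis
    using swap[symmetric] by (simp add: inner H_def set_lebesgue_integral_def mult.commute scaleR_conv_of_real)
qed

subsection \<open>Holomorphic functions of several variables\<close>

text \<open>The condition of \<open>holomorphic_on_vec\<close> at a single point, so that closure
  rules can be composed without reference to a domain.\<close>

definition cdiff :: "(complex ^ 'n \<Rightarrow> complex) \<Rightarrow> complex ^ 'n \<Rightarrow> bool"
  where "cdiff f z \<longleftrightarrow> (\<exists>D. (f has_derivative D) (at z) \<and> (\<forall>c v. D (c *s v) = c * D v))"

lemma holomorphic_on_vec_iff: "holomorphic_on_vec f \<Omega> \<longleftrightarrow> (\<forall>z\<in>\<Omega>. cdiff f z)"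
  by (simp add: holomorphic_on_vec_def cdiff_def)

lemma cdiff_const [intro]: "cdiff (\<lambda>z. a) z"
  unfolding cdiff_def by (rule exI[of _ "\<lambda>_. 0"]) auto

lemma cdiff_nth [intro]: "cdiff (\<lambda>z. z $ i) z"
  unfolding cdiff_def
  by (rule exI[of _ "\<lambda>v. v $ i"]) (auto intro: bounded_linear.has_derivative bounded_linear_vec_nth)

lemma cdiff_add [intro]:
  assumes "cdiff f z" "cdiff g z"
  shows "cdiff (\<lambda>z. f z + g z) z"
proof -
  obtain D E where "(f has_derivative D) (at z)" "\<forall>c v. D (c *s v) = c * D v"
    "(g has_derivative E) (at z)" "\<forall>c v. E (c *s v) = c * E v"
    using assms unfolding cdiff_def by blast
  then have "((\<lambda>z. f z + g z) has_derivative (\<lambda>v. D v + E v)) (at z) \<and>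
      (\<forall>c v. D (c *s v) + E (c *s v) = c * (D v + E v))"
    by (auto intro: has_derivative_add simp: distrib_left)
  then show ?thesis unfolding cdiff_def by (intro exI[of _ "\<lambda>v. D v + E v"])
qed

lemma cdiff_mult [intro]:
  assumes "cdiff f z" "cdiff g z"
  shows "cdiff (\<lambda>z. f z * g z) z"
proof -
  obtain D E where "(f has_derivative D) (at z)" "\<forall>c v. D (c *s v) = c * D v"
    "(g has_derivative E) (at z)" "\<forall>c v. E (c *s v) = c * E v"
    using assms unfolding cdiff_def by blast
  then have "((\<lambda>z. f z * g z) has_derivative (\<lambda>v. f z * E v + D v * g z)) (at z) \<and>
      (\<forall>c v. f z * E (c *s v) + D (c *s v) * g z = c * (f z * E v + D v * g z))"
    by (auto intro: has_derivative_mult simp: distrib_left)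
  then show ?thesis unfolding cdiff_def by (intro exI[of _ "\<lambda>v. f z * E v + D v * g z"])
qed

lemma cdiff_diff [intro]:
  assumes "cdiff f z" "cdiff g z"
  shows "cdiff (\<lambda>z. f z - g z) z"
  using cdiff_add[OF assms(1) cdiff_mult[OF cdiff_const[of "-1"] assms(2)]] by simp

lemma cdiff_power [intro]: "cdiff f z \<Longrightarrow> cdiff (\<lambda>z. f z ^ n) z"
  by (induction n) auto

lemma cdiff_divide [intro]:
  assumes "cdiff f z" "cdiff g z" "g z \<noteq> 0"
  shows "cdiff (\<lambda>z. f z / g z) z"
proof -
  obtain E where E: "(g has_derivative E) (at z)" "\<And>c v. E (c *s v) = c * E v"
    using assms(2) unfolding cdiff_def by blast
  have "cdiff (\<lambda>z. inverse (g z)) z"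
    unfolding cdiff_def
    by (rule exI[of _ "\<lambda>v. - (inverse (g z) * E v * inverse (g z))"])
      (use E assms(3) in \<open>auto intro!: has_derivative_inverse\<close>)
  then show ?thesis
    using cdiff_mult[OF assms(1)] by (simp add: divide_inverse)
qed

lemma cdiff_imp_isCont: "cdiff f z \<Longrightarrow> isCont f z"
  unfolding cdiff_def using has_derivative_continuous by blast

lemma holomorphic_on_vec_imp_continuous_on: "holomorphic_on_vec f \<Omega> \<Longrightarrow> continuous_on \<Omega> f"
  unfolding holomorphic_on_vec_iff
  using cdiff_imp_isCont continuous_at_imp_continuous_on by blast

text \<open>The bridge to one-variable theory. The curve is given by coordinates and reassembled
  from axis vectors to obtain its derivative as a map into the vector space.\<close>

lemma cdiff_along_curve:
  fixes \<gamma> :: "complex \<Rightarrow> complex ^ 'n"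
  assumes "(f has_derivative D) (at (\<gamma> t))" and D: "\<And>c v. D (c *s v) = c * D v"
    and \<gamma>: "\<And>i. ((\<lambda>t. \<gamma> t $ i) has_field_derivative \<gamma>' $ i) (at t)"
  shows "((\<lambda>t. f (\<gamma> t)) has_field_derivative D \<gamma>') (at t)"
proof -
  have sum: "(\<Sum>i\<in>UNIV. axis i (x $ i)) = x" for x :: "complex ^ 'n"
    by (simp add: vec_eq_iff axis_def sum.delta if_distrib cong: if_cong)
  have ax: "bounded_linear (axis i :: complex \<Rightarrow> complex ^ 'n)" for i
    by (intro linear_conv_bounded_linear[THEN iffD1] linearI) (auto simp: vec_eq_iff axis_def)
  have "((\<lambda>t. \<Sum>i\<in>UNIV. axis i (\<gamma> t $ i)) has_derivative
      (\<lambda>h. \<Sum>i\<in>UNIV. axis i (\<gamma>' $ i * h))) (at t)"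
    by (intro has_derivative_sum bounded_linear.has_derivative[OF ax]
        \<gamma>[unfolded has_field_derivative_def])
  also have "(\<lambda>h. \<Sum>i\<in>UNIV. axis i (\<gamma>' $ i * h)) = (\<lambda>h. h *s \<gamma>')"
    using sum[of "h *s \<gamma>'" for h] by (simp add: fun_eq_iff mult.commute)
  finally have "(\<gamma> has_derivative (\<lambda>h. h *s \<gamma>')) (at t)"
    by (simp only: sum)
  from has_derivative_compose[OF this assms(1)] show ?thesis
    by (simp add: has_field_derivative_def D mult.commute[of _ "D \<gamma>'"] mult_commute_abs)
qed

lemma cdiff_along_curve_field_differentiable:
  fixes \<gamma> :: "complex \<Rightarrow> complex ^ 'n"
  assumes "cdiff f (\<gamma> t)" and \<gamma>: "\<And>i. (\<lambda>t. \<gamma> t $ i) field_differentiable (at t)"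
  shows "(\<lambda>t. f (\<gamma> t)) field_differentiable (at t)"
proof -
  obtain D where D: "(f has_derivative D) (at (\<gamma> t))" "\<And>c v. D (c *s v) = c * D v"
    using assms(1) unfolding cdiff_def by blast
  obtain d where d: "\<And>i. ((\<lambda>t. \<gamma> t $ i) has_field_derivative d i) (at t)"
    using \<gamma> unfolding field_differentiable_def by metis
  show ?thesis
    using cdiff_along_curve[where f = f and D = D and \<gamma> = \<gamma> and t = t and \<gamma>' = "\<chi> i. d i"] D d
    unfolding field_differentiable_def by auto
qed

lemma norm_smult_vec: "norm (c *s v) = cmod c * norm (v :: complex ^ 'n)"
  by (simp add: norm_vec_def norm_mult L2_set_right_distrib)

text \<open>Cauchy's inequality on the complex line through \<open>z\<close> in direction
  \<open>v\<close>. The disc radius r / (2 |v|) keeps the closed disc inside the ball, which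
  accounts for the factor 2.\<close>

lemma cdiff_derivative_bound:
  fixes f :: "complex ^ 'n \<Rightarrow> complex"
  assumes f: "\<And>x. x \<in> ball z r \<Longrightarrow> cdiff f x" and r: "r > 0"
    and M: "\<And>x. x \<in> ball z r \<Longrightarrow> cmod (f x) \<le> M"
    and D: "(f has_derivative D) (at z)" "\<And>c v. D (c *s v) = c * D v"
  shows "cmod (D v) \<le> 2 * M / r * norm v"
proof (cases "v = 0")
  case True
  then show ?thesis using D(2)[of 0 v] by simp
next
  case False
  define \<rho> where "\<rho> = r / (2 * norm v)"
  have \<rho>: "\<rho> > 0" using r False by (simp add: \<rho>_def)
  define h where "h t = f (z + t *s v)" for t
  have mem: "z + t *s v \<in> ball z r" if "t \<in> cball 0 \<rho>" for t
  proof -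
    have "cmod t * norm v \<le> \<rho> * norm v" using that by (intro mult_right_mono) auto
    also have "\<dots> < r" using False r by (simp add: \<rho>_def)
    finally show ?thesis by (simp add: dist_norm norm_smult_vec)
  qed
  have hd: "h field_differentiable (at t)" if "t \<in> cball 0 \<rho>" for t
    unfolding h_def
    by (rule cdiff_along_curve_field_differentiable) (auto intro!: f mem that derivative_intros)
  have "cmod ((deriv ^^ 1) h 0) \<le> fact 1 * M / \<rho> ^ 1"
  proof (rule Cauchy_inequality)
    show "h holomorphic_on ball 0 \<rho>"
      by (auto simp: holomorphic_on_def intro!: field_differentiable_at_within hd)
    show "continuous_on (cball 0 \<rho>) h"
      by (intro continuous_at_imp_continuous_on ballI field_differentiable_imp_continuous_at hd)
    show "cmod (h x) \<le> M" if "cmod (0 - x) = \<rho>" for x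
      unfolding h_def by (intro M mem) (use that in auto)
  qed fact
  moreover have "(h has_field_derivative D v) (at 0)"
    unfolding h_def by (rule cdiff_along_curve) (use D in \<open>auto intro!: derivative_eq_intros\<close>)
  ultimately have "cmod (D v) \<le> M / \<rho>" by (simp add: DERIV_imp_deriv)
  then show ?thesis using False r by (simp add: \<rho>_def field_simps)
qed

text \<open>Weierstrass' convergence theorem: applied to differences, the derivative bound makes the
  derivatives uniformly Cauchy on the half ball, so limit and derivative may be exchanged. Complex
  homogeneity survives pointwise limits.\<close>

lemma cdiff_uniform_limit:
  fixes f :: "nat \<Rightarrow> complex ^ 'n \<Rightarrow> complex"
  assumes f: "\<And>n x. x \<in> ball z r \<Longrightarrow> cdiff (f n) x" and r: "r > 0"
    and lim: "uniform_limit (ball z r) f g sequentially"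
  shows "cdiff g z"
proof -
  let ?S = "ball z (r / 2)"
  have sub: "ball x (r / 2) \<subseteq> ball z r" if "x \<in> ?S" for x
  proof
    fix y assume "y \<in> ball x (r / 2)"
    then show "y \<in> ball z r" using that dist_triangle[of z y x] by auto
  qed
  have "\<forall>n. \<forall>x\<in>?S. \<exists>D. (f n has_derivative D) (at x) \<and> (\<forall>c v. D (c *s v) = c * D v)"
    using f r by (auto simp: cdiff_def)
  then obtain f' where f': "\<And>n x. x \<in> ?S \<Longrightarrow> (f n has_derivative f' n x) (at x)"
    "\<And>n x c v. x \<in> ?S \<Longrightarrow> f' n x (c *s v) = c * f' n x v"
    by metis
  have close: "\<exists>N. \<forall>n\<ge>N. \<forall>m\<ge>N. \<forall>x\<in>?S. \<forall>h. cmod (f' n x h - f' m x h) \<le> e * norm h" if "e > 0" for e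
  proof -
    \<comment> \<open>Two terms then differ by at most e r / 4, and the derivative bound on radius r
      / 2 turns this into exactly \<open>e\<close>.\<close>
    have "e * r / 8 > 0" using r that by simp
    with lim have "\<forall>\<^sub>F n in sequentially. \<forall>x\<in>ball z r. dist (f n x) (g x) < e * r / 8"
      unfolding uniform_limit_iff by blast
    then obtain N where N: "\<And>n x. n \<ge> N \<Longrightarrow> x \<in> ball z r \<Longrightarrow> dist (f n x) (g x) < e * r / 8"
      unfolding eventually_sequentially by blast
    show ?thesis
    proof (intro exI allI impI ballI)
      fix n m x h assume nm: "n \<ge> N" "m \<ge> N" and x: "x \<in> ?S"
      have "cmod (f' n x h - f' m x h) \<le> 2 * (e * r / 4) / (r / 2) * norm h"
      proof (rule cdiff_derivative_bound[where f = "\<lambda>x. f n x - f m x" and z = x])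
        show "cmod (f n y - f m y) \<le> e * r / 4" if "y \<in> ball x (r / 2)" for y
        proof -
          have y: "y \<in> ball z r" using sub[OF x] that by blast
          have "dist (f n y) (f m y) \<le> dist (f n y) (g y) + dist (f m y) (g y)"
            by (rule dist_triangle2)
          then show ?thesis using N[OF nm(1) y] N[OF nm(2) y] by (simp add: dist_norm)
        qed
        show "cdiff (\<lambda>x. f n x - f m x) y" if "y \<in> ball x (r / 2)" for y
          using f sub[OF x] that by (intro cdiff_diff) blast+
      qed (use f' x r in \<open>auto intro!: has_derivative_diff simp: algebra_simps\<close>)
      then show "cmod (f' n x h - f' m x h) \<le> e * norm h" using r by simp
    qed
  qed
  have conv: "convergent (\<lambda>n. f' n x h)" if x: "x \<in> ?S" for x h
    unfolding Cauchy_convergent_iff[symmetric]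
  proof (rule metric_CauchyI)
    fix e :: real assume e: "e > 0"
    then have "e / (norm h + 1) > 0" by (simp add: add_nonneg_pos)
    from close[OF this] obtain N where
      N: "\<And>n m. n \<ge> N \<Longrightarrow> m \<ge> N \<Longrightarrow> cmod (f' n x h - f' m x h) \<le> e / (norm h + 1) * norm h"
      using x by blast
    have "e / (norm h + 1) * norm h < e"
      using e by (simp add: divide_simps add_nonneg_pos)
    then show "\<exists>N. \<forall>m\<ge>N. \<forall>n\<ge>N. dist (f' m x h) (f' n x h) < e"
      unfolding dist_norm using le_less_trans[OF N] by blast
  qed
  define g' where "g' x h = lim (\<lambda>n. f' n x h)" for x h
  have g': "(\<lambda>n. f' n x h) \<longlonglongrightarrow> g' x h" if "x \<in> ?S" for x h
    using conv[OF that] by (simp add: g'_def convergent_LIMSEQ_iff)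
  have z: "z \<in> ?S" using r by simp
  have ptw: "(\<lambda>n. f n x) \<longlonglongrightarrow> g x" if "x \<in> ?S" for x
    using tendsto_uniform_limitI[OF lim] that r by auto
  have "\<exists>G. \<forall>x\<in>?S. (\<lambda>n. f n x) \<longlonglongrightarrow> G x \<and> (G has_derivative g' x) (at x within ?S)"
  proof (rule has_derivative_sequence)
    fix e :: real assume "e > 0"
    from close[OF this] obtain N where
      N: "\<And>n m x h. n \<ge> N \<Longrightarrow> m \<ge> N \<Longrightarrow> x \<in> ?S \<Longrightarrow> cmod (f' n x h - f' m x h) \<le> e * norm h"
      by blast
    show "\<forall>\<^sub>F n in sequentially. \<forall>x\<in>?S. \<forall>h. cmod (f' n x h - g' x h) \<le> e * norm h"
      unfolding eventually_sequentially
    proof (intro exI allI impI ballI)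
      fix n x h assume n: "n \<ge> N" and x: "x \<in> ?S"
      have "(\<lambda>m. cmod (f' n x h - f' m x h)) \<longlonglongrightarrow> cmod (f' n x h - g' x h)"
        by (intro tendsto_intros g' x)
      then show "cmod (f' n x h - g' x h) \<le> e * norm h"
        by (rule LIMSEQ_le_const2) (use N[OF n _ x] in blast)
    qed
  qed (use z ptw[OF z] f' in \<open>auto intro: has_derivative_at_withinI\<close>)
  then obtain G where G: "\<And>x. x \<in> ?S \<Longrightarrow> (\<lambda>n. f n x) \<longlonglongrightarrow> G x"
    "\<And>x. x \<in> ?S \<Longrightarrow> (G has_derivative g' x) (at x within ?S)" by blast
  have "G x = g x" if "x \<in> ?S" for x
    using G(1)[OF that] ptw[OF that] LIMSEQ_unique by blast
  then have "(g has_derivative g' z) (at z)"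
    using has_derivative_transform_within_open[of G "g' z" z UNIV ?S g] G(2)[OF z] z at_within_open[OF z]
    by auto
  moreover have "g' z (c *s v) = c * g' z v" for c v
  proof (rule LIMSEQ_unique[OF g'[OF z]])
    show "(\<lambda>n. f' n z (c *s v)) \<longlonglongrightarrow> c * g' z v"
      using tendsto_mult_left[OF g'[OF z], of c v] f'(2)[OF z] by simp
  qed
  ultimately show ?thesis unfolding cdiff_def by blast
qed

subsection \<open>Existence of the Bergman kernel\<close>

definition bergman_sqnorm :: "(complex ^ 'n) set \<Rightarrow> (complex ^ 'n \<Rightarrow> complex) \<Rightarrow> real"
  where "bergman_sqnorm \<Omega> f = (LINT z:\<Omega>|lborel. (norm (f z))\<^sup>2)"

lemma bergman_sqnorm_nonneg: "bergman_sqnorm \<Omega> f \<ge> 0"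
  unfolding bergman_sqnorm_def set_lebesgue_integral_def by (intro integral_nonneg_AE) auto

lemma bergman_sqnorm_scale: "bergman_sqnorm \<Omega> (\<lambda>z. c * f z) = (cmod c)\<^sup>2 * bergman_sqnorm \<Omega> f"
  unfolding bergman_sqnorm_def set_lebesgue_integral_def
  by (simp add: norm_mult power_mult_distrib mult.left_commute flip: integral_mult_right_zero)

context
  fixes \<Omega> :: "(complex ^ 'n) set"
  assumes \<Omega>: "open \<Omega>"
begin

lemma bergman_space_measurable:
  assumes "f \<in> bergman_space \<Omega>"
  shows "(\<lambda>z. indicator \<Omega> z *\<^sub>R f z) \<in> borel_measurable borel"
  using assms holomorphic_on_vec_imp_continuous_on \<Omega> unfolding bergman_space_def
  by (intro borel_measurable_continuous_on_indicator) auto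

lemma bergman_space_lincomb:
  assumes f: "f \<in> bergman_space \<Omega>" and g: "g \<in> bergman_space \<Omega>"
  shows "(\<lambda>z. a * f z + b * g z) \<in> bergman_space \<Omega>"
proof -
  have "set_integrable lborel \<Omega> (\<lambda>z. (norm (a * f z + b * g z))\<^sup>2)"
    unfolding set_integrable_def
  proof (rule Bochner_Integration.integrable_bound)
    show "integrable lborel (\<lambda>z. 2 * (cmod a)\<^sup>2 * (indicator \<Omega> z *\<^sub>R (norm (f z))\<^sup>2)
        + 2 * (cmod b)\<^sup>2 * (indicator \<Omega> z *\<^sub>R (norm (g z))\<^sup>2))"
      using f g unfolding bergman_space_def set_integrable_def
      by (intro Bochner_Integration.integrable_add integrable_mult_right) auto
    have "(\<lambda>z. (norm (a * (indicator \<Omega> z *\<^sub>R f z) + b * (indicator \<Omega> z *\<^sub>R g z)))\<^sup>2) \<in> borel_measurable lborel"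
      using bergman_space_measurable[OF f] bergman_space_measurable[OF g] by measurable
    also have "(\<lambda>z. (norm (a * (indicator \<Omega> z *\<^sub>R f z) + b * (indicator \<Omega> z *\<^sub>R g z)))\<^sup>2)
      = (\<lambda>z. indicator \<Omega> z *\<^sub>R (norm (a * f z + b * g z))\<^sup>2)"
      by (auto simp: indicator_def)
    finally show "\<dots> \<in> borel_measurable lborel" .
    have "(norm (x + y))\<^sup>2 \<le> 2 * (norm x)\<^sup>2 + 2 * (norm y)\<^sup>2" for x y :: complex
    proof -
      have "(norm (x + y))\<^sup>2 \<le> (norm x + norm y)\<^sup>2" by (simp add: norm_triangle_ineq power_mono)
      also have "\<dots> \<le> 2 * (norm x)\<^sup>2 + 2 * (norm y)\<^sup>2"
        using sum_squares_bound[of "norm x" "norm y"] by (simp add: power2_sum)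
      finally show ?thesis .
    qed
    from this[of "a * f z" "b * g z" for z] show "AE z in lborel. norm (indicator \<Omega> z *\<^sub>R (norm (a * f z + b * g z))\<^sup>2)
      \<le> norm (2 * (cmod a)\<^sup>2 * (indicator \<Omega> z *\<^sub>R (norm (f z))\<^sup>2)
        + 2 * (cmod b)\<^sup>2 * (indicator \<Omega> z *\<^sub>R (norm (g z))\<^sup>2))"
      by (auto simp: indicator_def norm_mult power_mult_distrib mult.assoc)
  qed
  then show ?thesis
    using f g unfolding bergman_space_def holomorphic_on_vec_iff
    by (auto intro!: cdiff_add cdiff_mult cdiff_const)
qed

lemma bergman_inner_integrable:
  assumes f: "f \<in> bergman_space \<Omega>" and g: "g \<in> bergman_space \<Omega>"
  shows "set_integrable lborel \<Omega> (\<lambda>z. f z * cnj (g z))"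
  unfolding set_integrable_def
proof (rule Bochner_Integration.integrable_bound)
  show "integrable lborel (\<lambda>z. indicator \<Omega> z *\<^sub>R (norm (f z))\<^sup>2 + indicator \<Omega> z *\<^sub>R (norm (g z))\<^sup>2)"
    using f g unfolding bergman_space_def set_integrable_def
    by (intro Bochner_Integration.integrable_add) auto
  have [measurable]: "cnj \<in> borel_measurable borel"
    by (intro borel_measurable_continuous_onI continuous_intros)
  have "(\<lambda>z. (indicator \<Omega> z *\<^sub>R f z) * cnj (indicator \<Omega> z *\<^sub>R g z)) \<in> borel_measurable lborel"
    using bergman_space_measurable[OF f] bergman_space_measurable[OF g] by measurable
  also have "(\<lambda>z. (indicator \<Omega> z *\<^sub>R f z) * cnj (indicator \<Omega> z *\<^sub>R g z))
    = (\<lambda>z. indicator \<Omega> z *\<^sub>R (f z * cnj (g z)))"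
    by (auto simp: indicator_def)
  finally show "\<dots> \<in> borel_measurable lborel" .
  have "norm x * norm y \<le> (norm x)\<^sup>2 + (norm y)\<^sup>2" for x y :: complex
    using sum_squares_bound[of "norm x" "norm y"] mult_nonneg_nonneg[OF norm_ge_zero[of x] norm_ge_zero[of y]]
    by linarith
  then show "AE z in lborel. norm (indicator \<Omega> z *\<^sub>R (f z * cnj (g z)))
      \<le> norm (indicator \<Omega> z *\<^sub>R (norm (f z))\<^sup>2 + indicator \<Omega> z *\<^sub>R (norm (g z))\<^sup>2)"
    by (auto simp: indicator_def norm_mult)
qed

text \<open>Serves twice in the existence proof: \<open>c = 1\<close> and \<open>c = -1\<close> give
  the parallelogram law, arbitrary \<open>c\<close> gives the variation of a minimizer.\<close>

lemma bergman_sqnorm_add: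
  assumes f: "f \<in> bergman_space \<Omega>" and g: "g \<in> bergman_space \<Omega>"
  shows "bergman_sqnorm \<Omega> (\<lambda>z. f z + c * g z)
    = bergman_sqnorm \<Omega> f + (cmod c)\<^sup>2 * bergman_sqnorm \<Omega> g + 2 * Re (c * bergman_inner \<Omega> g f)"
proof -
  have i: "set_integrable lborel \<Omega> (\<lambda>z. (norm (f z))\<^sup>2)" "set_integrable lborel \<Omega> (\<lambda>z. (norm (g z))\<^sup>2)"
    using f g by (auto simp: bergman_space_def)
  have j: "set_integrable lborel \<Omega> (\<lambda>z. c * (g z * cnj (f z)))"
    using bergman_inner_integrable[OF g f] by (rule set_integrable_mult_right)
  then have k: "set_integrable lborel \<Omega> (\<lambda>z. Re (c * (g z * cnj (f z))))"
    unfolding set_integrable_def using integrable_Re by fastforce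
  have "(norm (x + y))\<^sup>2 = (norm x)\<^sup>2 + (norm y)\<^sup>2 + 2 * Re (y * cnj x)" for x y
    unfolding cmod_power2 by (simp add: power2_eq_square algebra_simps)
  from this[of "f z" "c * g z" for z] have "(norm (f z + c * g z))\<^sup>2 = (norm (f z))\<^sup>2 + (cmod c)\<^sup>2 * (norm (g z))\<^sup>2
      + 2 * Re (c * (g z * cnj (f z)))" for z
    by (simp only: norm_mult power_mult_distrib mult.assoc)
  then have "bergman_sqnorm \<Omega> (\<lambda>z. f z + c * g z)
    = (LINT z:\<Omega>|lborel. (norm (f z))\<^sup>2 + (cmod c)\<^sup>2 * (norm (g z))\<^sup>2 + 2 * Re (c * (g z * cnj (f z))))"
    by (simp add: bergman_sqnorm_def)
  also have "\<dots> = (LINT z:\<Omega>|lborel. (norm (f z))\<^sup>2) + (cmod c)\<^sup>2 * (LINT z:\<Omega>|lborel. (norm (g z))\<^sup>2)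
      + 2 * (LINT z:\<Omega>|lborel. Re (c * (g z * cnj (f z))))"
  proof -
    define R where "R z = Re (c * (g z * cnj (f z)))" for z
    have "set_integrable lborel \<Omega> R" using k unfolding R_def .
    then show ?thesis
      unfolding R_def[symmetric] using i
      by (simp add: set_integral_add set_integral_mult_right set_integrable_mult_right)
  qed
  also have "(LINT z:\<Omega>|lborel. Re (c * (g z * cnj (f z)))) = Re (LINT z:\<Omega>|lborel. c * (g z * cnj (f z)))"
    using j unfolding set_lebesgue_integral_def set_integrable_def by (subst integral_Re[symmetric]) auto
  also have "\<dots> = Re (c * bergman_inner \<Omega> g f)"
    by (simp add: bergman_inner_def)
  finally show ?thesis by (simp add: bergman_sqnorm_def)
qed

text \<open>Point evaluation is bounded. The mean value property on a ball is applied to the square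
  of the translated function, so that the triangle inequality for integrals yields the squared norm
  directly.\<close>

lemma bergman_sup_bound:
  assumes f: "f \<in> bergman_space \<Omega>" and r: "r > 0" and sub: "ball z r \<subseteq> \<Omega>"
  shows "(cmod (f z))\<^sup>2 * measure lborel (ball (0 :: complex ^ 'n) r) \<le> bergman_sqnorm \<Omega> f"
proof -
  let ?B = "ball (0 :: complex ^ 'n) r"
  have fi: "set_integrable lborel \<Omega> (\<lambda>z. (norm (f z))\<^sup>2)" and fh: "\<And>x. x \<in> \<Omega> \<Longrightarrow> cdiff f x"
    using f by (auto simp: bergman_space_def holomorphic_on_vec_iff)
  have mem: "z + v \<in> \<Omega>" if "v \<in> ?B" for v
    using that by (intro subsetD[OF sub]) (simp add: dist_norm)
  have [measurable]: "\<Omega> \<in> sets borel" using \<Omega> by auto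
  have si: "set_integrable lborel (ball z r) (\<lambda>x. (norm (f x))\<^sup>2)"
    by (rule set_integrable_subset[OF fi]) (use sub in auto)
  have eq: "indicator (ball z r) (z + v) = (indicator ?B v :: real)" for v
    by (simp add: indicator_def dist_norm)
  have transl: "set_integrable lborel ?B (\<lambda>v. (norm (f (z + v)))\<^sup>2)"
    "(LINT v:?B|lborel. (norm (f (z + v)))\<^sup>2) = (LINT x:ball z r|lborel. (norm (f x))\<^sup>2)"
  proof -
    let ?h = "\<lambda>x. indicator (ball z r) x *\<^sub>R (norm (f x))\<^sup>2"
    have hm [measurable]: "?h \<in> borel_measurable borel"
      using si unfolding set_integrable_def by auto
    show "set_integrable lborel ?B (\<lambda>v. (norm (f (z + v)))\<^sup>2)"
      using integrable_distr_eq[of "(+) z" lborel borel ?h] si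
      by (simp add: set_integrable_def lborel_distr_plus eq)
    show "(LINT v:?B|lborel. (norm (f (z + v)))\<^sup>2) = (LINT x:ball z r|lborel. (norm (f x))\<^sup>2)"
      unfolding set_lebesgue_integral_def
      using integral_distr[OF _ hm, of "(+) z" lborel]
      by (simp add: lborel_distr_plus eq)
  qed
  have cont: "continuous_on ?B (\<lambda>v. (f (z + v))\<^sup>2)"
    using f \<Omega> mem sub unfolding bergman_space_def
    by (intro continuous_intros continuous_on_compose2[OF holomorphic_on_vec_imp_continuous_on[of f \<Omega>]]) auto
  have "(LINT v:?B|lborel. (f (z + v))\<^sup>2) = measure lborel ?B * (f (z + 0))\<^sup>2"
  proof (rule circular_mean_value[OF _ _ cont])
    show scale: "c *s v \<in> ?B" if "v \<in> ?B" "cmod c \<le> 1" for v c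
    proof -
      have "cmod c * norm v \<le> 1 * norm v" using that by (intro mult_right_mono) auto
      then show ?thesis using that by (simp add: norm_smult_vec)
    qed
    show "(\<lambda>c. (f (z + c *s v))\<^sup>2) holomorphic_on ball 0 1" if v: "v \<in> ?B" for v
    proof -
      have "(\<lambda>c. f (z + c *s v)) field_differentiable (at c)" if "c \<in> ball 0 1" for c
      proof (rule cdiff_along_curve_field_differentiable)
        show "cdiff f (z + c *s v)"
          by (intro fh mem scale v) (use that in auto)
        show "(\<lambda>c. (z + c *s v) $ i) field_differentiable (at c)" for i
          by (auto intro!: derivative_intros)
      qed
      then have "(\<lambda>c. f (z + c *s v)) holomorphic_on ball 0 1"
        unfolding holomorphic_on_def using field_differentiable_at_within by blast
      then show ?thesis by (rule holomorphic_on_power)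
    qed
    have "set_borel_measurable lborel ?B (\<lambda>v. (f (z + v))\<^sup>2)"
      using borel_measurable_continuous_on_indicator[OF _ cont] by (simp add: set_borel_measurable_def)
    then show "set_integrable lborel ?B (\<lambda>v. (f (z + v))\<^sup>2)"
      unfolding set_integrable_def set_borel_measurable_def
      by (intro Bochner_Integration.integrable_bound[OF transl(1)[unfolded set_integrable_def]])
        (auto simp: norm_power)
  qed simp
  then have "(cmod (f z))\<^sup>2 * measure lborel ?B = cmod (LINT v:?B|lborel. (f (z + v))\<^sup>2)"
    by (simp add: norm_mult norm_power)
  also have "\<dots> \<le> (LINT v:?B|lborel. (norm (f (z + v)))\<^sup>2)"
    unfolding set_lebesgue_integral_def
    by (rule order.trans[OF integral_norm_bound]) (simp add: norm_power)
  also have "\<dots> = (LINT x:ball z r|lborel. (norm (f x))\<^sup>2)" by (rule transl)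
  also have "\<dots> \<le> bergman_sqnorm \<Omega> f"
    unfolding bergman_sqnorm_def set_lebesgue_integral_def
    using si fi sub unfolding set_integrable_def by (intro integral_mono) (auto simp: indicator_def)
  finally show ?thesis .
qed

end

text \<open>Completeness in the form required for minimizing sequences: by the sup bound, Cauchy in
  norm implies locally uniform convergence, so the limit is holomorphic. An upper bound on its norm
  is enough when \<open>d\<close> is an infimum.\<close>

lemma bergman_space_pointwise_Cauchy_limit:
  fixes \<Omega> :: "(complex ^ 'n) set"
  assumes \<Omega>: "open \<Omega>" and f: "\<And>n. f n \<in> bergman_space \<Omega>"
    and Cauchy: "\<And>e. e > 0 \<Longrightarrow> \<exists>N. \<forall>m\<ge>N. \<forall>n\<ge>N. bergman_sqnorm \<Omega> (\<lambda>z. f m z - f n z) < e"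
    and bound: "(\<lambda>n. bergman_sqnorm \<Omega> (f n)) \<longlonglongrightarrow> d"
  obtains g where "g \<in> bergman_space \<Omega>" "bergman_sqnorm \<Omega> g \<le> d"
    "\<And>z. z \<in> \<Omega> \<Longrightarrow> (\<lambda>n. f n z) \<longlonglongrightarrow> g z"
proof -
  define g where "g z = lim (\<lambda>n. f n z)" for z
  have unif: "uniform_limit (ball z (r / 2)) f g sequentially"
    if r: "r > 0" and sub: "ball z r \<subseteq> \<Omega>" for z r
  proof -
    define V where "V = measure lborel (ball (0 :: complex ^ 'n) (r / 2))"
    have V: "V > 0" using r by (simp add: V_def content_ball_pos)
    have "uniformly_Cauchy_on (ball z (r / 2)) f"
    proof (rule uniformly_Cauchy_onI')
      fix e :: real assume e: "e > 0"
      then have "e\<^sup>2 * V > 0" using V by simp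
      from Cauchy[OF this] obtain N where
        N: "\<And>m n. m \<ge> N \<Longrightarrow> n \<ge> N \<Longrightarrow> bergman_sqnorm \<Omega> (\<lambda>z. f m z - f n z) < e\<^sup>2 * V" by blast
      show "\<exists>M. \<forall>x\<in>ball z (r / 2). \<forall>m\<ge>M. \<forall>n>m. dist (f m x) (f n x) < e"
      proof (intro exI ballI allI impI)
        fix x m n assume x: "x \<in> ball z (r / 2)" and m: "m \<ge> N" and n: "n > m"
        have "ball x (r / 2) \<subseteq> \<Omega>"
        proof (rule order.trans[OF _ sub], rule subsetI)
          fix y assume "y \<in> ball x (r / 2)"
          then show "y \<in> ball z r" using x dist_triangle[of z y x] by auto
        qed
        moreover have "(\<lambda>z. f m z - f n z) \<in> bergman_space \<Omega>"
          using bergman_space_lincomb[OF \<Omega> f f, of 1 m "-1" n] by simp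
        ultimately have "(cmod (f m x - f n x))\<^sup>2 * V \<le> bergman_sqnorm \<Omega> (\<lambda>z. f m z - f n z)"
          using bergman_sup_bound[OF \<Omega>, of "\<lambda>z. f m z - f n z" "r / 2" x] r by (simp add: V_def)
        also have "\<dots> < e\<^sup>2 * V" using N m n by auto
        finally have "(cmod (f m x - f n x))\<^sup>2 < e\<^sup>2" using V by simp
        then show "dist (f m x) (f n x) < e"
          using e by (simp add: dist_norm power_less_imp_less_base)
      qed
    qed
    then show ?thesis
      unfolding g_def uniformly_convergent_uniform_limit_iff[symmetric]
      by (simp add: uniformly_convergent_eq_Cauchy Cauchy_uniformly_convergent)
  qed
  have nbhd: "\<exists>r>0. ball z r \<subseteq> \<Omega>" if "z \<in> \<Omega>" for z
    using \<Omega> that by (simp add: open_contains_ball)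
  have lim: "(\<lambda>n. f n z) \<longlonglongrightarrow> g z" if "z \<in> \<Omega>" for z
    using nbhd[OF that] unif by (fastforce intro: tendsto_uniform_limitI)
  have hol: "holomorphic_on_vec g \<Omega>"
    unfolding holomorphic_on_vec_iff
  proof
    fix z assume "z \<in> \<Omega>"
    with nbhd obtain r where r: "r > 0" "ball z r \<subseteq> \<Omega>" by blast
    show "cdiff g z"
    proof (rule cdiff_uniform_limit[OF _ _ unif[OF r]])
      show "cdiff (f n) x" if "x \<in> ball z (r / 2)" for n x
        using f[of n] r(2) subsetD[OF subset_ball[of "r / 2" r z] that] r(1)
        by (auto simp: bergman_space_def holomorphic_on_vec_iff subset_iff)
    qed (use r in auto)
  qed
  have d: "d \<ge> 0" using LIMSEQ_le_const[OF bound, of 0] bergman_sqnorm_nonneg by blast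
  have [measurable]: "(\<lambda>z. indicator \<Omega> z *\<^sub>R (norm (g z))\<^sup>2) \<in> borel_measurable borel"
    using holomorphic_on_vec_imp_continuous_on[OF hol] \<Omega>
    by (intro borel_measurable_continuous_on_indicator continuous_intros) auto
  have [measurable]: "(\<lambda>z. indicator \<Omega> z *\<^sub>R (norm (f n z))\<^sup>2) \<in> borel_measurable borel" for n
    using f[of n] borel_measurable_integrable unfolding bergman_space_def set_integrable_def by fastforce
  have nn: "(\<integral>\<^sup>+z. ennreal (indicator \<Omega> z *\<^sub>R (norm (f n z))\<^sup>2) \<partial>lborel) = ennreal (bergman_sqnorm \<Omega> (f n))" for n
    using f[of n] unfolding bergman_space_def bergman_sqnorm_def set_integrable_def set_lebesgue_integral_def
    by (intro nn_integral_eq_integral) auto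
  \<comment> \<open>Fatou's lemma yields square integrability of the limit together with the norm
    bound.\<close>
  have "(\<integral>\<^sup>+z. ennreal (indicator \<Omega> z *\<^sub>R (norm (g z))\<^sup>2) \<partial>lborel)
      \<le> (\<integral>\<^sup>+z. liminf (\<lambda>n. ennreal (indicator \<Omega> z *\<^sub>R (norm (f n z))\<^sup>2)) \<partial>lborel)"
  proof (rule nn_integral_mono)
    fix z
    have lm: "(\<lambda>n. ennreal (indicator \<Omega> z *\<^sub>R (norm (f n z))\<^sup>2)) \<longlonglongrightarrow> ennreal (indicator \<Omega> z *\<^sub>R (norm (g z))\<^sup>2)"
      using lim by (cases "z \<in> \<Omega>") (auto intro!: tendsto_intros)
    show "ennreal (indicator \<Omega> z *\<^sub>R (norm (g z))\<^sup>2)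
        \<le> liminf (\<lambda>n. ennreal (indicator \<Omega> z *\<^sub>R (norm (f n z))\<^sup>2))"
      unfolding lim_imp_Liminf[OF sequentially_bot lm] by (rule order.refl)
  qed
  also have "\<dots> \<le> liminf (\<lambda>n. \<integral>\<^sup>+z. ennreal (indicator \<Omega> z *\<^sub>R (norm (f n z))\<^sup>2) \<partial>lborel)"
    by (rule nn_integral_liminf) measurable
  also have "\<dots> = ennreal d"
    unfolding nn by (rule lim_imp_Liminf) (auto intro!: tendsto_ennrealI bound)
  finally have le: "(\<integral>\<^sup>+z. ennreal (indicator \<Omega> z *\<^sub>R (norm (g z))\<^sup>2) \<partial>lborel) \<le> ennreal d" .
  have int: "integrable lborel (\<lambda>z. indicator \<Omega> z *\<^sub>R (norm (g z))\<^sup>2)"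
    using le by (intro integrableI_nonneg) (auto simp: le_less_trans scaleR_nonneg_nonneg simp del: real_scaleR_def)
  show ?thesis
  proof
    show "g \<in> bergman_space \<Omega>"
      using hol int by (simp add: bergman_space_def set_integrable_def)
    have "ennreal (bergman_sqnorm \<Omega> g) \<le> ennreal d"
      unfolding bergman_sqnorm_def set_lebesgue_integral_def
      using le nn_integral_eq_integral[OF int] by simp
    then show "bergman_sqnorm \<Omega> g \<le> d" using d by simp
  qed (fact lim)
qed

text \<open>First-order condition at a minimum. For \<open>c = - t * cnj a\<close> the form equals
  |a|^2 t (t b - 2), and this \<open>t\<close> is small enough that t b < 1.\<close>

lemma quadratic_nonneg_imp_linear_zero:
  fixes a :: complex and b :: real
  assumes "\<And>c. (cmod c)\<^sup>2 * b + 2 * Re (c * a) \<ge> 0"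
  shows "a = 0"
proof (rule ccontr)
  assume a: "a \<noteq> 0"
  define t where "t = 1 / (\<bar>b\<bar> + 1)"
  have t: "t > 0" "t * b < 1" unfolding t_def by (auto simp: divide_simps)
  have "(cmod (- of_real t * cnj a))\<^sup>2 * b + 2 * Re (- of_real t * cnj a * a) = (cmod a)\<^sup>2 * t * (t * b - 2)"
    by (simp add: norm_mult power_mult_distrib cmod_power2) (simp add: power2_eq_square algebra_simps)
  moreover have "(cmod a)\<^sup>2 * t * (t * b - 2) < 0"
    using a t by (intro mult_pos_neg) auto
  ultimately show False using assms[of "- of_real t * cnj a"] by linarith
qed

text \<open>Riesz representation by hand: if \<open>g\<close> has minimal norm among the functions
  with value 1 at \<zeta>, then \<open>g\<close> divided by its squared norm represents evaluation
  at \<zeta>.\<close>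

theorem bergman_kernel_exists:
  fixes \<Omega> :: "(complex ^ 'n) set"
  assumes \<Omega>: "open \<Omega>"
  shows "\<exists>K. is_bergman_kernel \<Omega> K"
proof -
  have "\<exists>k\<in>bergman_space \<Omega>. \<forall>f\<in>bergman_space \<Omega>. f \<zeta> = bergman_inner \<Omega> f k" if \<zeta>: "\<zeta> \<in> \<Omega>" for \<zeta>
  proof (cases "\<forall>f\<in>bergman_space \<Omega>. f \<zeta> = 0")
    \<comment> \<open>No function can be normalized at \<zeta> here; the zero function represents
      evaluation.\<close>
    case True
    then show ?thesis
      by (intro bexI[of _ "\<lambda>_. 0"])
        (auto simp: bergman_space_def bergman_inner_def holomorphic_on_vec_iff set_integrable_def)
  next
    case False
    then obtain f0 where f0: "f0 \<in> bergman_space \<Omega>" "f0 \<zeta> \<noteq> 0" by blast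
    define A where "A = {f \<in> bergman_space \<Omega>. f \<zeta> = 1}"
    define d where "d = Inf (bergman_sqnorm \<Omega> ` A)"
    have "(\<lambda>z. inverse (f0 \<zeta>) * f0 z + 0 * f0 z) \<in> A"
      unfolding A_def using f0 bergman_space_lincomb[OF \<Omega> f0(1) f0(1), of "inverse (f0 \<zeta>)" 0] by simp
    then have ne: "bergman_sqnorm \<Omega> ` A \<noteq> {}" by blast
    have bdd: "bdd_below (bergman_sqnorm \<Omega> ` A)"
      using bergman_sqnorm_nonneg by (intro bdd_belowI[of _ 0]) auto
    have d_le: "d \<le> bergman_sqnorm \<Omega> f" if "f \<in> A" for f
      unfolding d_def by (rule cInf_lower[OF _ bdd]) (use that in auto)
    have "\<exists>f\<in>A. bergman_sqnorm \<Omega> f < d + 1 / real (Suc n)" for n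
      using cInf_lessD[OF ne, of "d + 1 / real (Suc n)"] by (auto simp: d_def)
    then obtain f where f: "\<And>n. f n \<in> A" "\<And>n. bergman_sqnorm \<Omega> (f n) < d + 1 / real (Suc n)" by metis
    have fB: "f n \<in> bergman_space \<Omega>" and f1: "f n \<zeta> = 1" for n using f by (auto simp: A_def)
    have inv: "(\<lambda>n. 1 / real (Suc n)) \<longlonglongrightarrow> 0"
      using LIMSEQ_inverse_real_of_nat by (simp add: inverse_eq_divide)
    have Cauchy: "bergman_sqnorm \<Omega> (\<lambda>z. f m z - f n z) \<le> 2 / real (Suc m) + 2 / real (Suc n)" for m n
    proof -
      \<comment> \<open>The midpoint is again a competitor, so its squared norm is at least
        \<open>d\<close>; the parallelogram law then forces the difference to be small.\<close>
      have mid: "(\<lambda>z. (1 / 2) * f m z + (1 / 2) * f n z) \<in> A"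
        using bergman_space_lincomb[OF \<Omega> fB fB, of "1/2" m "1/2" n] f1 by (simp add: A_def)
      have "bergman_sqnorm \<Omega> (\<lambda>z. f m z + 1 * f n z) + bergman_sqnorm \<Omega> (\<lambda>z. f m z + (-1) * f n z)
          = 2 * bergman_sqnorm \<Omega> (f m) + 2 * bergman_sqnorm \<Omega> (f n)"
        unfolding bergman_sqnorm_add[OF \<Omega> fB fB] by simp
      moreover have "bergman_sqnorm \<Omega> (\<lambda>z. f m z + 1 * f n z) \<ge> 4 * d"
        using d_le[OF mid] bergman_sqnorm_scale[of \<Omega> "1/2" "\<lambda>z. f m z + 1 * f n z"]
        by (simp add: distrib_left power2_eq_square)
      ultimately show ?thesis using f(2)[of m] f(2)[of n] by simp
    qed
    have small: "\<exists>N. \<forall>m\<ge>N. \<forall>n\<ge>N. bergman_sqnorm \<Omega> (\<lambda>z. f m z - f n z) < e" if "e > 0" for e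
    proof -
      have "\<forall>\<^sub>F n in sequentially. 1 / real (Suc n) < e / 4"
        using order_tendstoD(2)[OF inv, of "e / 4"] that by simp
      then obtain N where N: "\<And>n. n \<ge> N \<Longrightarrow> 1 / real (Suc n) < e / 4"
        unfolding eventually_sequentially by blast
      show ?thesis
      proof (intro exI allI impI)
        fix m n assume "m \<ge> N" "n \<ge> N"
        then show "bergman_sqnorm \<Omega> (\<lambda>z. f m z - f n z) < e"
          using Cauchy[of m n] N[of m] N[of n] by linarith
      qed
    qed
    have to_d: "(\<lambda>n. bergman_sqnorm \<Omega> (f n)) \<longlonglongrightarrow> d"
    proof (rule tendsto_sandwich[of "\<lambda>_. d" _ _ "\<lambda>n. d + 1 / real (Suc n)"])
      show "(\<lambda>n. d + 1 / real (Suc n)) \<longlonglongrightarrow> d"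
        using tendsto_add[OF tendsto_const inv, of d] by simp
      show "\<forall>\<^sub>F n in sequentially. bergman_sqnorm \<Omega> (f n) \<le> d + 1 / real (Suc n)"
        using less_imp_le[OF f(2)] by (rule always_eventually[OF allI])
    qed (use d_le f in \<open>auto intro!: always_eventually\<close>)
    obtain g where g: "g \<in> bergman_space \<Omega>" "bergman_sqnorm \<Omega> g \<le> d"
      "\<And>z. z \<in> \<Omega> \<Longrightarrow> (\<lambda>n. f n z) \<longlonglongrightarrow> g z"
      using bergman_space_pointwise_Cauchy_limit[OF \<Omega> fB small to_d] by blast
    have g1: "g \<zeta> = 1" using g(3)[OF \<zeta>] f1 by (simp add: LIMSEQ_const_iff)
    \<comment> \<open>Adding a multiple of a function that vanishes at \<zeta> keeps the
      normalization, so minimality makes such a function orthogonal to \<open>g\<close>.\<close>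
    have orth: "bergman_inner \<Omega> h g = 0" if h: "h \<in> bergman_space \<Omega>" "h \<zeta> = 0" for h
    proof (rule quadratic_nonneg_imp_linear_zero)
      fix c
      have "(\<lambda>z. g z + c * h z) \<in> A"
        using bergman_space_lincomb[OF \<Omega> g(1) h(1), of 1 c] h g1 by (simp add: A_def)
      then show "(cmod c)\<^sup>2 * bergman_sqnorm \<Omega> h + 2 * Re (c * bergman_inner \<Omega> h g) \<ge> 0"
        using d_le g(2) bergman_sqnorm_add[OF \<Omega> g(1) h(1), of c] by fastforce
    qed
    obtain r where r: "r > 0" "ball \<zeta> r \<subseteq> \<Omega>" using \<Omega> \<zeta> open_contains_ball by blast
    have "bergman_sqnorm \<Omega> g > 0"
      using bergman_sup_bound[OF \<Omega> g(1) r] content_ball_pos[OF r(1), of "0 :: complex ^ 'n"]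
      unfolding g1 norm_one power_one mult_1 by linarith
    define N where "N = bergman_sqnorm \<Omega> g"
    have N: "N > 0" unfolding N_def by fact
    have gg: "bergman_inner \<Omega> g g = of_real N"
      by (simp add: bergman_inner_def N_def bergman_sqnorm_def set_lebesgue_integral_def
          complex_norm_square[symmetric] scaleR_conv_of_real flip: of_real_power of_real_mult integral_of_real)
    show ?thesis
    proof (intro bexI ballI)
      show "(\<lambda>z. inverse (of_real N) * g z) \<in> bergman_space \<Omega>"
        using bergman_space_lincomb[OF \<Omega> g(1) g(1), of "inverse (of_real N)" 0] by simp
      fix h assume h: "h \<in> bergman_space \<Omega>"
      \<comment> \<open>Subtracting \<open>h \<zeta> * g\<close> leaves a function vanishing at
        \<zeta>, to which \<open>orth\<close> applies.\<close>
      have k: "(\<lambda>z. h z - h \<zeta> * g z) \<in> bergman_space \<Omega>"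
        using bergman_space_lincomb[OF \<Omega> h g(1), of 1 "- h \<zeta>"] by simp
      have "bergman_inner \<Omega> h g = bergman_inner \<Omega> (\<lambda>z. h z - h \<zeta> * g z) g + h \<zeta> * bergman_inner \<Omega> g g"
      proof -
        have "h z * cnj (g z) = (h z - h \<zeta> * g z) * cnj (g z) + h \<zeta> * (g z * cnj (g z))" for z
          by (simp add: algebra_simps)
        then have "bergman_inner \<Omega> h g
            = (LINT z:\<Omega>|lborel. (h z - h \<zeta> * g z) * cnj (g z) + h \<zeta> * (g z * cnj (g z)))"
          by (simp only: bergman_inner_def)
        also have "\<dots> = (LINT z:\<Omega>|lborel. (h z - h \<zeta> * g z) * cnj (g z))
            + (LINT z:\<Omega>|lborel. h \<zeta> * (g z * cnj (g z)))"
          by (intro set_integral_add bergman_inner_integrable[OF \<Omega> k g(1)]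
              set_integrable_mult_right bergman_inner_integrable[OF \<Omega> g(1) g(1)])
        finally show ?thesis by (simp only: bergman_inner_def set_integral_mult_right)
      qed
      also have "\<dots> = h \<zeta> * of_real N" using orth[OF k] g1 by (simp add: gg)
      finally have "bergman_inner \<Omega> h g = h \<zeta> * of_real N" .
      moreover have "bergman_inner \<Omega> h (\<lambda>z. inverse (of_real N) * g z) = inverse (of_real N) * bergman_inner \<Omega> h g"
        unfolding bergman_inner_def by (subst set_integral_mult_right[symmetric]) (simp add: mult.left_commute)
      ultimately show "h \<zeta> = bergman_inner \<Omega> h (\<lambda>z. inverse (of_real N) * g z)"
        using N by simp
    qed
  qed
  then obtain k where "\<And>\<zeta>. \<zeta> \<in> \<Omega> \<Longrightarrow> k \<zeta> \<in> bergman_space \<Omega> \<and> (\<forall>f\<in>bergman_space \<Omega>. f \<zeta> = bergman_inner \<Omega> f (k \<zeta>))"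
    by metis
  then have "is_bergman_kernel \<Omega> (\<lambda>z \<zeta>. k \<zeta> z)" by (simp add: is_bergman_kernel_def)
  then show ?thesis by blast
qed

subsection \<open>Holomorphic substitution in the plane\<close>

lemma nn_integral_lborel_isometry:
  fixes h :: "'a::euclidean_space \<Rightarrow> 'b::euclidean_space"
  assumes "linear h" "\<And>x. norm (h x) = norm x" "DIM('a) = DIM('b)" and [measurable]: "f \<in> borel_measurable borel"
  shows "(\<integral>\<^sup>+x. f (h x) \<partial>lborel) = (\<integral>\<^sup>+y. f y \<partial>lborel)"
proof -
  have [measurable]: "h \<in> borel_measurable borel"
    using assms(1) by (intro borel_measurable_continuous_onI linear_continuous_on linear_conv_bounded_linear[THEN iffD1])
  show ?thesis
    using nn_integral_distr[of h lborel borel f] lborel_distr_linear_isometry[OF assms(1-3)] by simp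
qed

text \<open>The determinant form of the change of variables is stated on \<open>real ^ 'n\<close>;
  this isometry moves the plane there.\<close>

definition complex_of_vec2 :: "real ^ 2 \<Rightarrow> complex"
  where "complex_of_vec2 v = Complex (v $ 1) (v $ 2)"

definition vec2_of_complex :: "complex \<Rightarrow> real ^ 2"
  where "vec2_of_complex z = vector [Re z, Im z]"

lemma vec2_complex_inverse [simp]:
  "complex_of_vec2 (vec2_of_complex z) = z" "vec2_of_complex (complex_of_vec2 v) = v"
  by (simp_all add: complex_of_vec2_def vec2_of_complex_def vec_eq_iff forall_2)

lemma linear_complex_of_vec2: "linear complex_of_vec2"
  by (rule linearI) (auto simp: complex_of_vec2_def complex_eq_iff)

lemma linear_vec2_of_complex: "linear vec2_of_complex"
  by (rule linearI) (auto simp: vec2_of_complex_def vec_eq_iff forall_2)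

lemma norm_complex_of_vec2: "norm (complex_of_vec2 v) = norm v"
  by (simp add: complex_of_vec2_def norm_vec_def L2_set_def sum_2 complex_norm)

lemma det_complex_mult: "det (matrix (\<lambda>u. vec2_of_complex (d * complex_of_vec2 u))) = (cmod d)\<^sup>2"
  by (simp add: det_2 matrix_def vec2_of_complex_def complex_of_vec2_def axis_def cmod_power2)
    (simp add: power2_eq_square)

text \<open>Multiplication by g' has real determinant |g'|^2. Boundedness of \<open>A\<close> gives
  the finite measure required by \<open>has_measure_differentiable_image\<close>; the next lemma
  removes it by exhaustion.\<close>

lemma emeasure_holomorphic_image:
  assumes S: "open S" and g: "\<And>x. x \<in> S \<Longrightarrow> (g has_field_derivative g' x) (at x)" and inj: "inj_on g S"
    and g': "continuous_on S g'" and A: "A \<in> sets borel" "bounded A" "A \<subseteq> g ` S"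
  shows "(\<integral>\<^sup>+x. ennreal ((cmod (g' x))\<^sup>2) * indicator (S \<inter> g -` A) x \<partial>lborel) = emeasure lborel A"
proof -
  let ?h = complex_of_vec2 and ?k = vec2_of_complex
  define B where "B = S \<inter> g -` A"
  define F where "F x = ?k (g (?h x))" for x
  have cg: "continuous_on S g"
    using g by (intro continuous_at_imp_continuous_on ballI DERIV_isCont) auto
  have Bb [measurable]: "B \<in> sets borel"
  proof -
    have [measurable]: "(\<lambda>x. indicator S x *\<^sub>R g x) \<in> borel_measurable borel"
      using S cg by (intro borel_measurable_continuous_on_indicator) auto
    have [measurable]: "S \<in> sets borel" "A \<in> sets borel" using S A by auto
    have "B = S \<inter> (\<lambda>x. indicator S x *\<^sub>R g x) -` A" by (auto simp: B_def)
    also have "\<dots> \<in> sets borel" by measurable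
    finally show ?thesis .
  qed
  have hm [measurable]: "?h \<in> borel_measurable borel"
    by (intro borel_measurable_continuous_onI linear_continuous_on linear_conv_bounded_linear[THEN iffD1]
        linear_complex_of_vec2)
  have bl: "bounded_linear ?h" "bounded_linear ?k"
    using linear_complex_of_vec2 linear_vec2_of_complex by (simp_all add: linear_conv_bounded_linear)
  have vim: "?h -` X \<in> sets borel" if "X \<in> sets borel" for X
    using measurable_sets[OF hm that] by simp
  have vimk: "?h -` X = ?k ` X" for X
    by (auto simp: image_iff) (metis vec2_complex_inverse(2))
  have lm: "?h -` A \<in> lmeasurable"
    using vim[OF A(1)] A(2) bl(2)
    by (intro bounded_set_imp_lmeasurable) (auto simp: vimk intro: bounded_linear_image)
  have im: "F ` (?h -` B) = ?h -` A"
  proof -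
    have "?h ` (?h -` B) = B" by (metis surj_image_vimage_eq surj_def vec2_complex_inverse(1))
    moreover have "g ` B = A" using A(3) by (auto simp: B_def)
    ultimately show ?thesis unfolding F_def vimk by (metis image_image)
  qed
  have "((\<lambda>x. \<bar>det (matrix (\<lambda>u. ?k (g' (?h x) * ?h u)))\<bar>) has_integral measure lebesgue (?h -` A)) (?h -` B)"
  proof (rule has_measure_differentiable_image[THEN iffD1])
    show "F ` (?h -` B) \<in> lmeasurable \<and> measure lebesgue (F ` (?h -` B)) = measure lebesgue (?h -` A)"
      using lm by (simp add: im)
    show "?h -` B \<in> sets lebesgue" using vim[OF Bb] by simp
    show "inj_on F (?h -` B)"
      using inj by (auto simp: inj_on_def F_def B_def) (metis vec2_complex_inverse)+
    fix x assume "x \<in> ?h -` B"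
    then have "(g has_derivative (\<lambda>u. g' (?h x) * u)) (at (?h x))"
      using g[of "?h x"] by (simp add: B_def has_field_derivative_def)
    from bounded_linear.has_derivative[OF bl(2) has_derivative_compose[OF bounded_linear_imp_has_derivative[OF bl(1)] this]]
    show "(F has_derivative (\<lambda>u. ?k (g' (?h x) * ?h u))) (at x within ?h -` B)"
      unfolding F_def by (rule has_derivative_at_withinI)
  qed
  then have "(\<integral>\<^sup>+x. ennreal ((cmod (g' (?h x)))\<^sup>2) * indicator (?h -` B) x \<partial>lborel) = measure lebesgue (?h -` A)"
    by (intro nn_integral_has_integral_lebesgue') (auto simp: det_complex_mult)
  also have "\<dots> = emeasure lborel (?h -` A)"
    using lm vim[OF A(1)] by (simp add: emeasure_eq_ennreal_measure fmeasurable_def)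
  also have "\<dots> = emeasure (distr lborel borel ?h) A"
    using A(1) by (simp add: emeasure_distr)
  also have "\<dots> = emeasure lborel A"
    by (simp add: lborel_distr_linear_isometry linear_complex_of_vec2 norm_complex_of_vec2)
  finally have *: "(\<integral>\<^sup>+x. ennreal ((cmod (g' (?h x)))\<^sup>2) * indicator (?h -` B) x \<partial>lborel) = emeasure lborel A" .
  have "(\<lambda>x. indicator S x *\<^sub>R g' x) \<in> borel_measurable borel"
    using S g' by (intro borel_measurable_continuous_on_indicator) auto
  then have "(\<lambda>x. ennreal ((cmod (indicator S x *\<^sub>R g' x))\<^sup>2) * indicator B x) \<in> borel_measurable borel"
    by measurable
  also have "(\<lambda>x. ennreal ((cmod (indicator S x *\<^sub>R g' x))\<^sup>2) * indicator B x)
      = (\<lambda>x. ennreal ((cmod (g' x))\<^sup>2) * indicator B x)"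
    by (auto simp: B_def indicator_def)
  finally show ?thesis
    using nn_integral_lborel_isometry[OF linear_complex_of_vec2 norm_complex_of_vec2, of "\<lambda>x. ennreal ((cmod (g' x))\<^sup>2) * indicator B x"] *
    by (simp add: B_def indicator_vimage flip: vimage_Int)
qed

text \<open>Both sides integrate \<open>f\<close>, against the image of a weighted measure and
  against \<open>lborel\<close> restricted to the image of \<open>S\<close>. These measures agree on
  bounded Borel sets, hence everywhere.\<close>

lemma nn_integral_holomorphic_substitution:
  fixes f :: "complex \<Rightarrow> ennreal"
  assumes S: "open S" and g: "\<And>x. x \<in> S \<Longrightarrow> (g has_field_derivative g' x) (at x)" and inj: "inj_on g S"
    and g': "continuous_on S g'" and gS: "g ` S \<in> sets borel" and f [measurable]: "f \<in> borel_measurable borel"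
  shows "(\<integral>\<^sup>+x. f (g x) * ennreal ((cmod (g' x))\<^sup>2) * indicator S x \<partial>lborel)
    = (\<integral>\<^sup>+y. f y * indicator (g ` S) y \<partial>lborel)"
proof -
  \<comment> \<open>Outside \<open>S\<close> the map is set to 0 for global measurability; the
    weight \<open>w\<close> vanishes there.\<close>
  define G where "G x = indicator S x *\<^sub>R g x" for x
  define w where "w x = ennreal ((cmod (indicator S x *\<^sub>R g' x))\<^sup>2)" for x
  have cg: "continuous_on S g"
    using g by (intro continuous_at_imp_continuous_on ballI DERIV_isCont) auto
  have [measurable]: "G \<in> borel_measurable borel"
    unfolding G_def using S cg by (intro borel_measurable_continuous_on_indicator) auto
  have [measurable]: "(\<lambda>x. indicator S x *\<^sub>R g' x) \<in> borel_measurable borel"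
    using S g' by (intro borel_measurable_continuous_on_indicator) auto
  have [measurable]: "w \<in> borel_measurable borel"
    unfolding w_def by measurable
  have [measurable]: "g ` S \<in> sets borel" "S \<in> sets borel" using S gS by auto
  define M where "M = distr (density lborel w) borel G"
  define N where "N = density lborel (indicator (g ` S) :: complex \<Rightarrow> ennreal)"
  have sM: "sets M = sets borel" "sets N = sets borel" by (simp_all add: M_def N_def)
  have fin: "emeasure M A = emeasure N A" if [measurable]: "A \<in> sets borel" and bA: "bounded A" for A
  proof -
    have "emeasure M A = (\<integral>\<^sup>+x. w x * indicator (G -` A) x \<partial>lborel)"
      using measurable_sets[of G borel borel A]
      by (simp add: M_def emeasure_distr emeasure_density)
    also have "\<dots> = (\<integral>\<^sup>+x. ennreal ((cmod (g' x))\<^sup>2) * indicator (S \<inter> g -` (A \<inter> g ` S)) x \<partial>lborel)"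
      by (intro nn_integral_cong) (auto simp: w_def G_def indicator_def)
    also have "\<dots> = emeasure lborel (A \<inter> g ` S)"
      using bA by (intro emeasure_holomorphic_image[OF S g inj g']) (auto intro: bounded_Int)
    also have "\<dots> = emeasure N A"
      unfolding N_def by (subst emeasure_density) (auto simp: Int_commute simp flip: indicator_inter_arith)
    finally show ?thesis .
  qed
  have "M = N"
  proof (rule measure_eqI)
    fix A assume "A \<in> sets M"
    then have [measurable]: "A \<in> sets borel" by (simp add: sM)
    define Q where "Q n = A \<inter> ball 0 (real n)" for n
    have Q: "incseq Q" "(\<Union>n. Q n) = A"
      using reals_Archimedean2 by (auto simp: Q_def incseq_def)
    have "emeasure M (Q n) = emeasure N (Q n)" for n
      by (rule fin) (auto simp: Q_def intro: bounded_Int)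
    moreover have "range Q \<subseteq> sets borel" by (auto simp: Q_def)
    ultimately show "emeasure M A = emeasure N A"
      using SUP_emeasure_incseq[of Q M] SUP_emeasure_incseq[of Q N] Q by (simp add: sM)
  qed (simp add: sM)
  have "(\<integral>\<^sup>+x. f (g x) * ennreal ((cmod (g' x))\<^sup>2) * indicator S x \<partial>lborel) = (\<integral>\<^sup>+x. w x * f (G x) \<partial>lborel)"
    by (intro nn_integral_cong) (auto simp: w_def G_def indicator_def mult_ac)
  also have "\<dots> = (\<integral>\<^sup>+y. f y \<partial>M)"
    by (simp add: M_def nn_integral_distr nn_integral_density)
  also have "\<dots> = (\<integral>\<^sup>+y. f y * indicator (g ` S) y \<partial>lborel)"
    unfolding \<open>M = N\<close> by (simp add: N_def nn_integral_density mult.commute)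
  finally show ?thesis .
qed

lemma nn_integral_complex_affine:
  assumes [measurable]: "f \<in> borel_measurable borel" and a: "a \<noteq> 0"
  shows "(\<integral>\<^sup>+x. f (a * x + b) \<partial>lborel) = ennreal (1 / (cmod a)\<^sup>2) * (\<integral>\<^sup>+y. f y \<partial>lborel)"
proof -
  have surj: "(\<lambda>x. a * x + b) ` UNIV = UNIV"
    using a by (intro surjI[of _ "\<lambda>y. (y - b) / a"]) auto
  have "(\<integral>\<^sup>+x. f (a * x + b) * ennreal ((cmod a)\<^sup>2) * indicator UNIV x \<partial>lborel)
      = (\<integral>\<^sup>+y. f y * indicator ((\<lambda>x. a * x + b) ` UNIV) y \<partial>lborel)"
    by (rule nn_integral_holomorphic_substitution)
      (use a in \<open>auto simp: surj inj_on_def intro!: derivative_eq_intros\<close>)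
  then have "(\<integral>\<^sup>+x. f (a * x + b) \<partial>lborel) * ennreal ((cmod a)\<^sup>2) = (\<integral>\<^sup>+y. f y \<partial>lborel)"
    by (simp add: surj nn_integral_multc)
  then have "(\<integral>\<^sup>+y. f y \<partial>lborel) * ennreal (1 / (cmod a)\<^sup>2)
      = (\<integral>\<^sup>+x. f (a * x + b) \<partial>lborel) * (ennreal ((cmod a)\<^sup>2) * ennreal (1 / (cmod a)\<^sup>2))"
    by (simp add: mult.assoc[symmetric])
  also have "ennreal ((cmod a)\<^sup>2) * ennreal (1 / (cmod a)\<^sup>2) = 1"
    using a by (simp flip: ennreal_mult')
  finally show ?thesis by (simp add: mult.commute)
qed

text \<open>The derivative of 1/x has squared modulus 1/|x|^4. The origin is a null set, and there
  the weight is 0 by the convention 1/0 = 0.\<close>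

lemma nn_integral_complex_inverse:
  assumes [measurable]: "f \<in> borel_measurable borel"
  shows "(\<integral>\<^sup>+x. f (1 / x) * ennreal (1 / cmod x ^ 4) \<partial>lborel) = (\<integral>\<^sup>+y. f y \<partial>lborel)"
proof -
  have im: "(\<lambda>x. 1 / x) ` (- {0}) = - {0 :: complex}"
  proof (intro equalityI subsetI)
    fix x :: complex assume "x \<in> - {0}"
    then show "x \<in> (\<lambda>x. 1 / x) ` (- {0})" by (intro image_eqI[of _ _ "1 / x"]) auto
  qed auto
  have "(\<integral>\<^sup>+x. f (1 / x) * ennreal ((cmod (- 1 / x\<^sup>2))\<^sup>2) * indicator (- {0}) x \<partial>lborel)
      = (\<integral>\<^sup>+y. f y * indicator ((\<lambda>x. 1 / x) ` (- {0})) y \<partial>lborel)"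
    by (rule nn_integral_holomorphic_substitution)
      (auto simp: im inj_on_def power2_eq_square intro!: derivative_eq_intros continuous_intros)
  also have "\<dots> = (\<integral>\<^sup>+y. f y \<partial>lborel)"
    unfolding im using AE_lborel_singleton[of "0 :: complex"]
    by (intro nn_integral_cong_AE) (auto elim!: eventually_mono)
  also have "(\<integral>\<^sup>+x. f (1 / x) * ennreal ((cmod (- 1 / x\<^sup>2))\<^sup>2) * indicator (- {0}) x \<partial>lborel)
      = (\<integral>\<^sup>+x. f (1 / x) * ennreal (1 / cmod x ^ 4) \<partial>lborel)"
    by (intro nn_integral_cong) (auto simp: norm_divide norm_power power_divide indicator_def)
  finally show ?thesis .
qed

text \<open>Squaring maps the right and the left half-plane each bijectively onto the plane slit
  along the nonpositive reals. The imaginary axis and the slit are null sets, so the integral is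
  counted twice.\<close>

lemma nn_integral_complex_square:
  assumes [measurable]: "f \<in> borel_measurable borel"
  shows "(\<integral>\<^sup>+x. f (x\<^sup>2) * ennreal (4 * (cmod x)\<^sup>2) \<partial>lborel) = 2 * (\<integral>\<^sup>+y. f y \<partial>lborel)"
proof -
  define P where "P = {z. 0 < Re z}"
  define N where "N = {z. Re z < 0}"
  define F where "F x = f (x\<^sup>2) * ennreal (4 * (cmod x)\<^sup>2)" for x
  have op: "open P" "open N"
    by (simp_all add: P_def N_def open_halfspace_Re_gt open_halfspace_Re_lt)
  then have [measurable]: "P \<in> sets borel" "N \<in> sets borel" by simp_all
  have [measurable]: "F \<in> borel_measurable borel" unfolding F_def by measurable
  have imP: "(\<lambda>x. x\<^sup>2) ` P = - \<real>\<^sub>\<le>\<^sub>0"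
  proof (intro equalityI subsetI)
    fix z assume "z \<in> (\<lambda>x. x\<^sup>2) ` P"
    then show "z \<in> - \<real>\<^sub>\<le>\<^sub>0"
      by (auto simp: P_def complex_nonpos_Reals_iff power2_eq_square mult_le_0_iff)
  next
    fix z :: complex assume "z \<in> - \<real>\<^sub>\<le>\<^sub>0"
    have "Re (csqrt z) \<noteq> 0"
    proof
      assume "Re (csqrt z) = 0"
      then have "Re ((csqrt z)\<^sup>2) \<le> 0" "Im ((csqrt z)\<^sup>2) = 0"
        by (simp_all add: power2_eq_square del: power2_csqrt csqrt.sel)
      then show False using \<open>z \<in> - \<real>\<^sub>\<le>\<^sub>0\<close> by (simp add: complex_nonpos_Reals_iff)
    qed
    then have "csqrt z \<in> P" using csqrt_principal[of z] by (auto simp: P_def)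
    then show "z \<in> (\<lambda>x. x\<^sup>2) ` P" by (intro image_eqI[of _ _ "csqrt z"]) auto
  qed
  have "N = uminus ` P" by (auto simp: N_def P_def image_iff intro!: exI[of _ "- z" for z])
  then have imN: "(\<lambda>x. x\<^sup>2) ` N = - \<real>\<^sub>\<le>\<^sub>0"
    by (simp add: image_image imP)
  have null: "{z :: complex. u \<bullet> z = 0} \<in> null_sets lborel" if "u \<noteq> 0" for u
  proof -
    have "closed {z :: complex. u \<bullet> z = 0}" by (rule closed_hyperplane)
    then show ?thesis
      using negligible_hyperplane[of u 0] that
      by (simp add: negligible_iff_null_sets null_sets_completion_iff)
  qed
  have half: "(\<integral>\<^sup>+x. F x * indicator S x \<partial>lborel) = (\<integral>\<^sup>+y. f y \<partial>lborel)"
    if S: "open S" "(\<lambda>x. x\<^sup>2) ` S = - \<real>\<^sub>\<le>\<^sub>0" "inj_on (\<lambda>x. x\<^sup>2) S" for S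
  proof -
    have "(\<integral>\<^sup>+x. f (x\<^sup>2) * ennreal ((cmod (2 * x))\<^sup>2) * indicator S x \<partial>lborel)
        = (\<integral>\<^sup>+y. f y * indicator ((\<lambda>x. x\<^sup>2) ` S) y \<partial>lborel)"
    proof (rule nn_integral_holomorphic_substitution)
      show "(\<lambda>x. x\<^sup>2) ` S \<in> sets borel" unfolding S(2) by (intro borel_comp borel_closed) simp
    qed (use S in \<open>auto intro!: derivative_eq_intros continuous_intros\<close>)
    also have "\<dots> = (\<integral>\<^sup>+y. f y \<partial>lborel)"
      using null[of \<i>] unfolding S(2)
      by (intro nn_integral_cong_AE) (auto intro!: AE_I'[of "{z. \<i> \<bullet> z = 0}"]
          simp: inner_complex_def indicator_def complex_nonpos_Reals_iff)
    finally show ?thesis by (simp add: F_def norm_mult power_mult_distrib)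
  qed
  have "x = y" if "x\<^sup>2 = y\<^sup>2" "x \<noteq> - y" for x y :: complex
    using that by (auto simp: power2_eq_iff)
  then have inj: "inj_on (\<lambda>x. x\<^sup>2) P" "inj_on (\<lambda>x. x\<^sup>2) N"
    by (auto simp: inj_on_def P_def N_def) (metis neg_less_0_iff_less not_less_iff_gr_or_eq uminus_complex.sel(1))+
  have "(\<integral>\<^sup>+x. F x \<partial>lborel) = (\<integral>\<^sup>+x. F x * indicator P x + F x * indicator N x \<partial>lborel)"
    using null[of 1]
    by (intro nn_integral_cong_AE) (auto intro!: AE_I'[of "{z. 1 \<bullet> z = 0}"]
        simp: inner_complex_def indicator_def P_def N_def)
  also have "\<dots> = (\<integral>\<^sup>+y. f y \<partial>lborel) + (\<integral>\<^sup>+y. f y \<partial>lborel)"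
    by (subst nn_integral_add) (simp_all add: half op imP imN inj)
  finally show ?thesis by (simp add: F_def mult_2)
qed

subsection \<open>Substitution in three complex variables\<close>

lemma nn_integral_affine_euclidean:
  fixes f :: "'a::euclidean_space \<Rightarrow> ennreal"
  assumes c: "c \<noteq> 0" and [measurable]: "f \<in> borel_measurable borel"
  shows "ennreal (\<bar>c\<bar> ^ DIM('a)) * (\<integral>\<^sup>+x. f (t + c *\<^sub>R x) \<partial>lborel) = (\<integral>\<^sup>+y. f y \<partial>lborel)"
  by (subst (2) lborel_affine[OF c, of t]) (simp add: nn_integral_density nn_integral_distr nn_integral_cmult)

lemma vector_3_eq_iff: "x = (y :: 'a ^ 3) \<longleftrightarrow> x $ 1 = y $ 1 \<and> x $ 2 = y $ 2 \<and> x $ 3 = y $ 3"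
  by (simp add: vec_eq_iff forall_3)

lemma continuous_on_vector_3 [continuous_intros]:
  fixes f g h :: "'b::topological_space \<Rightarrow> complex"
  assumes "continuous_on S f" "continuous_on S g" "continuous_on S h"
  shows "continuous_on S (\<lambda>x. vector [f x, g x, h x] :: complex ^ 3)"
proof -
  have "(\<lambda>x. vector [f x, g x, h x] :: complex ^ 3) = (\<lambda>x. \<chi> i. if i = 1 then f x else if i = 2 then g x else h x)"
    by (auto simp: fun_eq_iff vector_3_eq_iff)
  moreover have "continuous_on S (\<lambda>x. if i = (1 :: 3) then f x else if i = 2 then g x else h x)" for i
    using assms by (cases "i = 1"; cases "i = 2") auto
  ultimately show ?thesis by (simp only: continuous_on_vec_lambda)
qed

lemma measurable_vector_3 [measurable (raw)]:
  assumes [measurable]: "f \<in> borel_measurable M" "g \<in> borel_measurable M" "h \<in> borel_measurable M"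
  shows "(\<lambda>x. vector [f x, g x, h x] :: complex ^ 3) \<in> borel_measurable M"
proof -
  have "(\<lambda>(a, b, c). vector [a, b, c] :: complex ^ 3) \<in> borel_measurable borel"
    unfolding case_prod_unfold by (intro borel_measurable_continuous_onI continuous_intros)
  then have "(\<lambda>(a, b, c). vector [a, b, c] :: complex ^ 3) \<in> borel_measurable (borel \<Otimes>\<^sub>M borel \<Otimes>\<^sub>M borel)"
    by (simp add: borel_prod)
  then have "(\<lambda>x. (\<lambda>(a, b, c). vector [a, b, c] :: complex ^ 3) (f x, g x, h x)) \<in> borel_measurable M"
    by (rule measurable_compose[rotated]) measurable
  then show ?thesis by simp
qed

lemma measurable_vec_nth [measurable (raw)]:
  fixes f :: "'b \<Rightarrow> complex ^ 'n"
  assumes "f \<in> borel_measurable M"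
  shows "(\<lambda>x. f x $ i) \<in> borel_measurable M"
  by (rule measurable_compose[OF assms borel_measurable_continuous_onI[OF linear_continuous_on]])
    (rule bounded_linear_vec_nth)

lemma nn_integral_lborel_pair:
  fixes g :: "'a::euclidean_space \<times> 'b::euclidean_space \<Rightarrow> ennreal"
  assumes "g \<in> borel_measurable borel"
  shows "(\<integral>\<^sup>+p. g p \<partial>lborel) = (\<integral>\<^sup>+a. \<integral>\<^sup>+b. g (a, b) \<partial>lborel \<partial>lborel)"
proof -
  have "g \<in> borel_measurable (lborel \<Otimes>\<^sub>M lborel)"
    using assms by (simp add: lborel_prod)
  from lborel.nn_integral_fst[OF this] show ?thesis by (simp add: lborel_prod)
qed

lemma nn_integral_vec3:
  assumes [measurable]: "f \<in> borel_measurable borel"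
  shows "(\<integral>\<^sup>+x. f x \<partial>lborel) = (\<integral>\<^sup>+a. \<integral>\<^sup>+b. \<integral>\<^sup>+z. f (vector [a, b, z] :: complex ^ 3) \<partial>lborel \<partial>lborel \<partial>lborel)"
proof -
  let ?h = "\<lambda>p. vector [fst p, fst (snd p), snd (snd p)] :: complex ^ 3"
  have "(\<integral>\<^sup>+p. f (?h p) \<partial>lborel) = (\<integral>\<^sup>+x. f x \<partial>lborel)"
  proof (rule nn_integral_lborel_isometry)
    show "linear ?h"
      by (rule linearI) (auto simp: vector_3_eq_iff)
    show "norm (?h p) = norm p" for p
      by (simp add: norm_vec_def L2_set_def sum_3 norm_prod_def)
  qed simp_all
  also have "(\<integral>\<^sup>+p. f (?h p) \<partial>lborel) = (\<integral>\<^sup>+a. \<integral>\<^sup>+q. f (?h (a, q)) \<partial>lborel \<partial>lborel)"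
    by (rule nn_integral_lborel_pair) (simp flip: borel_prod)
  also have "\<dots> = (\<integral>\<^sup>+a. \<integral>\<^sup>+b. \<integral>\<^sup>+z. f (?h (a, b, z)) \<partial>lborel \<partial>lborel \<partial>lborel)"
    by (intro nn_integral_cong nn_integral_lborel_pair) (simp flip: borel_prod)
  finally show ?thesis by simp
qed

lemma nn_integral_complex_substitute_affine:
  assumes a: "a \<noteq> 0" and [measurable]: "h \<in> borel_measurable borel"
  shows "(\<integral>\<^sup>+b. h b \<partial>lborel) = (\<integral>\<^sup>+d. h (a * d + c) * ennreal ((cmod a)\<^sup>2) \<partial>lborel)"
proof -
  have "(\<integral>\<^sup>+d. h (a * d + c) * ennreal ((cmod a)\<^sup>2) \<partial>lborel)
      = (ennreal (1 / (cmod a)\<^sup>2) * ennreal ((cmod a)\<^sup>2)) * (\<integral>\<^sup>+b. h b \<partial>lborel)"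
    by (subst nn_integral_multc, simp, subst nn_integral_complex_affine) (use a in \<open>auto simp: mult_ac\<close>)
  also have "ennreal (1 / (cmod a)\<^sup>2) * ennreal ((cmod a)\<^sup>2) = 1"
    using a by (simp flip: ennreal_mult')
  finally show ?thesis by simp
qed

text \<open>Swapping the columns of a symmetric matrix turns \<open>x\<close> into the matrix \<open>X = [[x$3, x$2], [x$1, x$3]]\<close>,
  whose determinant is \<open>swap_det x\<close> and whose inverse is again of this form, given by \<open>swap_inv x\<close>.\<close>

definition swap_det :: "complex ^ 3 \<Rightarrow> complex"
  where "swap_det x = (x $ 3)\<^sup>2 - x $ 1 * x $ 2"

definition swap_inv :: "complex ^ 3 \<Rightarrow> complex ^ 3"
  where "swap_inv x = vector [- x $ 1 / swap_det x, - x $ 2 / swap_det x, x $ 3 / swap_det x]"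

lemma swap_det_measurable [measurable]: "swap_det \<in> borel_measurable borel"
  unfolding swap_det_def[abs_def] by measurable

lemma swap_inv_measurable [measurable]: "swap_inv \<in> borel_measurable borel"
  unfolding swap_inv_def[abs_def] by measurable

text \<open>Replacing \<open>b\<close> by the determinant d = z^2 - a b as a coordinate, the
  inversion becomes (a, z, d) \<mapsto> (-a/d, z/d, 1/d). For fixed \<open>d\<close> it only
  rescales \<open>a\<close> and \<open>z\<close>, and what remains is the inversion of
  \<open>d\<close>, so every Jacobian is one of a single variable.\<close>

lemma nn_integral_swap_inv:
  assumes f [measurable]: "f \<in> borel_measurable borel"
  shows "(\<integral>\<^sup>+x. f (swap_inv x) * ennreal (1 / cmod (swap_det x) ^ 6) \<partial>lborel) = (\<integral>\<^sup>+x. f x \<partial>lborel)"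
proof -
  define F where "F a b z = f (vector [a, b, z])" for a b z
  have F [measurable]: "(\<lambda>x. F (p x) (q x) (r x)) \<in> borel_measurable M"
    if [measurable]: "p \<in> borel_measurable M" "q \<in> borel_measurable M" "r \<in> borel_measurable M"
    for p q r and M :: "'b measure"
    unfolding F_def by measurable
  have swap: "(\<integral>\<^sup>+x. \<integral>\<^sup>+y. h x y \<partial>lborel \<partial>lborel) = (\<integral>\<^sup>+y. \<integral>\<^sup>+x. h x y \<partial>lborel \<partial>lborel)"
    if "case_prod h \<in> borel_measurable (borel \<Otimes>\<^sub>M borel)" for h :: "complex \<Rightarrow> complex \<Rightarrow> ennreal"
    using that by (intro lborel_pair.Fubini') (simp cong: measurable_cong_sets)
  \<comment> \<open>Passes from \<open>b\<close> to d = c - a b, where \<open>c\<close> will be z^2,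
    for fixed nonzero \<open>a\<close>.\<close>
  have elim_b: "(\<integral>\<^sup>+b. h b \<partial>lborel) = (\<integral>\<^sup>+d. h ((c - d) / a) * ennreal (1 / (cmod a)\<^sup>2) \<partial>lborel)"
    if "a \<noteq> 0" and h: "h \<in> borel_measurable borel" for h and a c :: complex
  proof -
    have "(\<integral>\<^sup>+b. h b \<partial>lborel) = (\<integral>\<^sup>+d. h ((- 1 / a) * d + c / a) * ennreal ((cmod (- 1 / a))\<^sup>2) \<partial>lborel)"
      by (rule nn_integral_complex_substitute_affine) (use that in auto)
    then show ?thesis by (simp add: diff_divide_distrib norm_divide power_divide)
  qed
  \<comment> \<open>The integrand in the coordinates (a, z, d), including the factor 1/|a|^2 from
    eliminating \<open>b\<close>.\<close>
  define H where "H a z d = F (- a / d) (- ((z\<^sup>2 - d) / a) / d) (z / d) * ennreal (1 / cmod d ^ 6)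
      * ennreal (1 / (cmod a)\<^sup>2)" for a z d
  have H [measurable]: "(\<lambda>x. H (p x) (q x) (r x)) \<in> borel_measurable M"
    if [measurable]: "p \<in> borel_measurable M" "q \<in> borel_measurable M" "r \<in> borel_measurable M"
    for p q r and M :: "'b measure"
    unfolding H_def by measurable
  \<comment> \<open>The integrand after rescaling \<open>a\<close> by \<open>- d\<close> and
    \<open>z\<close> by \<open>d\<close>. The powers of |d| combine to |d|^-4, exactly the weight
    absorbed by the substitution d \<mapsto> 1/d.\<close>
  define L where "L a z d = F a ((z\<^sup>2 - 1 / d) / a) z * ennreal (1 / (cmod a)\<^sup>2) * ennreal (1 / cmod d ^ 4)" for a z d
  have L [measurable]: "(\<lambda>x. L (p x) (q x) (r x)) \<in> borel_measurable M"
    if [measurable]: "p \<in> borel_measurable M" "q \<in> borel_measurable M" "r \<in> borel_measurable M"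
    for p q r and M :: "'b measure"
    unfolding L_def by measurable
  have "(\<integral>\<^sup>+x. f (swap_inv x) * ennreal (1 / cmod (swap_det x) ^ 6) \<partial>lborel)
    = (\<integral>\<^sup>+a. \<integral>\<^sup>+b. \<integral>\<^sup>+z. F (- a / (z\<^sup>2 - a * b)) (- b / (z\<^sup>2 - a * b)) (z / (z\<^sup>2 - a * b))
        * ennreal (1 / cmod (z\<^sup>2 - a * b) ^ 6) \<partial>lborel \<partial>lborel \<partial>lborel)"
    by (subst nn_integral_vec3) (auto simp: F_def swap_inv_def swap_det_def)
  also have "\<dots> = (\<integral>\<^sup>+a. \<integral>\<^sup>+z. \<integral>\<^sup>+b. F (- a / (z\<^sup>2 - a * b)) (- b / (z\<^sup>2 - a * b)) (z / (z\<^sup>2 - a * b))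
        * ennreal (1 / cmod (z\<^sup>2 - a * b) ^ 6) \<partial>lborel \<partial>lborel \<partial>lborel)"
    by (intro nn_integral_cong swap) measurable
  also have "\<dots> = (\<integral>\<^sup>+a. \<integral>\<^sup>+z. \<integral>\<^sup>+d. H a z d \<partial>lborel \<partial>lborel \<partial>lborel)"
  proof (rule nn_integral_cong_AE, rule eventually_mono[OF AE_lborel_singleton], rule nn_integral_cong)
    fix a z :: complex assume a: "a \<noteq> 0"
    show "(\<integral>\<^sup>+b. F (- a / (z\<^sup>2 - a * b)) (- b / (z\<^sup>2 - a * b)) (z / (z\<^sup>2 - a * b))
        * ennreal (1 / cmod (z\<^sup>2 - a * b) ^ 6) \<partial>lborel) = (\<integral>\<^sup>+d. H a z d \<partial>lborel)"
      by (subst elim_b[of a _ "z\<^sup>2"]) (use a in \<open>auto simp: H_def[abs_def]\<close>)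
  qed
  also have "\<dots> = (\<integral>\<^sup>+a. \<integral>\<^sup>+d. \<integral>\<^sup>+z. H a z d \<partial>lborel \<partial>lborel \<partial>lborel)"
    by (intro nn_integral_cong swap) measurable
  also have "\<dots> = (\<integral>\<^sup>+d. \<integral>\<^sup>+a. \<integral>\<^sup>+z. H a z d \<partial>lborel \<partial>lborel \<partial>lborel)"
    by (intro swap) measurable
  also have "\<dots> = (\<integral>\<^sup>+d. \<integral>\<^sup>+a. \<integral>\<^sup>+z. L a z d \<partial>lborel \<partial>lborel \<partial>lborel)"
  proof (rule nn_integral_cong_AE, rule eventually_mono[OF AE_lborel_singleton])
    fix d :: complex assume d: "d \<noteq> 0"
    have "(\<integral>\<^sup>+a. \<integral>\<^sup>+z. H a z d \<partial>lborel \<partial>lborel)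
      = (\<integral>\<^sup>+a. (\<integral>\<^sup>+z. H ((- d) * a + 0) z d \<partial>lborel) * ennreal ((cmod (- d))\<^sup>2) \<partial>lborel)"
      by (rule nn_integral_complex_substitute_affine) (use d in auto)
    also have "\<dots> = (\<integral>\<^sup>+a. (\<integral>\<^sup>+z. H ((- d) * a + 0) (d * z + 0) d * ennreal ((cmod d)\<^sup>2) \<partial>lborel)
        * ennreal ((cmod (- d))\<^sup>2) \<partial>lborel)"
      by (subst (2) nn_integral_complex_substitute_affine[where a = d and c = 0]) (use d in auto)
    also have "\<dots> = (\<integral>\<^sup>+a. \<integral>\<^sup>+z. H ((- d) * a + 0) (d * z + 0) d * ennreal ((cmod d)\<^sup>2)
        * ennreal ((cmod (- d))\<^sup>2) \<partial>lborel \<partial>lborel)"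
      by (subst nn_integral_multc) auto
    also have "\<dots> = (\<integral>\<^sup>+a. \<integral>\<^sup>+z. L a z d \<partial>lborel \<partial>lborel)"
    proof (intro nn_integral_cong)
      fix a z
      have "- (((d * z)\<^sup>2 - d) / (- d * a)) / d = (z\<^sup>2 - 1 / d) / a"
        using d by (cases "a = 0") (simp_all add: field_simps power2_eq_square)
      moreover have "1 / cmod d ^ 6 * (1 / (cmod (- d * a))\<^sup>2) * (cmod d)\<^sup>2 * (cmod (- d))\<^sup>2
          = 1 / (cmod a)\<^sup>2 * (1 / cmod d ^ 4)"
        using d by (cases "a = 0") (simp_all add: norm_mult field_simps power_mult_distrib)
      ultimately show "H ((- d) * a + 0) (d * z + 0) d * ennreal ((cmod d)\<^sup>2) * ennreal ((cmod (- d))\<^sup>2) = L a z d"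
        using d by (simp add: H_def L_def mult.assoc flip: ennreal_mult')
    qed
    finally show "(\<integral>\<^sup>+a. \<integral>\<^sup>+z. H a z d \<partial>lborel \<partial>lborel) = (\<integral>\<^sup>+a. \<integral>\<^sup>+z. L a z d \<partial>lborel \<partial>lborel)" .
  qed
  also have "\<dots> = (\<integral>\<^sup>+a. \<integral>\<^sup>+d. \<integral>\<^sup>+z. L a z d \<partial>lborel \<partial>lborel \<partial>lborel)"
    by (intro swap) measurable
  also have "\<dots> = (\<integral>\<^sup>+a. \<integral>\<^sup>+z. \<integral>\<^sup>+d. L a z d \<partial>lborel \<partial>lborel \<partial>lborel)"
    by (intro nn_integral_cong swap) measurable
  also have "\<dots> = (\<integral>\<^sup>+a. \<integral>\<^sup>+z. \<integral>\<^sup>+b. F a b z \<partial>lborel \<partial>lborel \<partial>lborel)"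
  proof (rule nn_integral_cong_AE, rule eventually_mono[OF AE_lborel_singleton], rule nn_integral_cong)
    fix a z :: complex assume a: "a \<noteq> 0"
    have "(\<integral>\<^sup>+d. L a z d \<partial>lborel) = (\<integral>\<^sup>+d. F a ((z\<^sup>2 - d) / a) z * ennreal (1 / (cmod a)\<^sup>2) \<partial>lborel)"
      unfolding L_def by (rule nn_integral_complex_inverse) measurable
    also have "\<dots> = (\<integral>\<^sup>+b. F a b z \<partial>lborel)"
      by (rule elim_b[symmetric]) (use a in auto)
    finally show "(\<integral>\<^sup>+d. L a z d \<partial>lborel) = (\<integral>\<^sup>+b. F a b z \<partial>lborel)" .
  qed
  also have "\<dots> = (\<integral>\<^sup>+a. \<integral>\<^sup>+b. \<integral>\<^sup>+z. F a b z \<partial>lborel \<partial>lborel \<partial>lborel)"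
    by (intro nn_integral_cong swap) measurable
  also have "\<dots> = (\<integral>\<^sup>+x. f x \<partial>lborel)"
    by (subst nn_integral_vec3) (auto simp: F_def[abs_def])
  finally show ?thesis .
qed

section \<open>Integration over the branched double cover\<close>

lemma tetrablock_map_measurable [measurable]: "tetrablock_map \<in> borel_measurable borel"
  unfolding tetrablock_map_def[abs_def] by measurable

text \<open>For fixed first two coordinates only the third changes, by squaring and then by a
  reflection with a shift, which preserves the integral. The factor 2 counts the sheets.\<close>

lemma nn_integral_tetrablock_map:
  assumes f [measurable]: "f \<in> borel_measurable borel"
  shows "(\<integral>\<^sup>+x. f (tetrablock_map x) * ennreal (4 * (cmod (x $ 3))\<^sup>2) \<partial>lborel) = 2 * (\<integral>\<^sup>+x. f x \<partial>lborel)"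
proof -
  have "(\<integral>\<^sup>+x. f (tetrablock_map x) * ennreal (4 * (cmod (x $ 3))\<^sup>2) \<partial>lborel)
    = (\<integral>\<^sup>+a. \<integral>\<^sup>+b. \<integral>\<^sup>+z. f (vector [a, b, a * b - z\<^sup>2]) * ennreal (4 * (cmod z)\<^sup>2) \<partial>lborel \<partial>lborel \<partial>lborel)"
    by (subst nn_integral_vec3) (auto simp: tetrablock_map_def)
  also have "\<dots> = (\<integral>\<^sup>+a. \<integral>\<^sup>+b. 2 * (\<integral>\<^sup>+z. f (vector [a, b, a * b - z]) \<partial>lborel) \<partial>lborel \<partial>lborel)"
    by (intro nn_integral_cong nn_integral_complex_square) measurable
  also have "\<dots> = (\<integral>\<^sup>+a. \<integral>\<^sup>+b. 2 * (\<integral>\<^sup>+z. f (vector [a, b, z]) \<partial>lborel) \<partial>lborel \<partial>lborel)"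
  proof -
    have "(\<integral>\<^sup>+z. f (vector [a, b, a * b - z]) \<partial>lborel) = (\<integral>\<^sup>+z. f (vector [a, b, z]) \<partial>lborel)" for a b
      using nn_integral_complex_substitute_affine[of "-1" "\<lambda>z. f (vector [a, b, z])" "a * b"] by simp
    then show ?thesis by simp
  qed
  also have "\<dots> = 2 * (\<integral>\<^sup>+x. f x \<partial>lborel)"
    by (subst nn_integral_vec3) (auto simp: nn_integral_cmult)
  finally show ?thesis .
qed

subsection \<open>Geometry of \<open>R_II\<close> and the tetrablock\<close>

definition R_II_sum :: "complex ^ 3 \<Rightarrow> real"
  where "R_II_sum x = (cmod (x $ 1))\<^sup>2 + (cmod (x $ 2))\<^sup>2 + 2 * (cmod (x $ 3))\<^sup>2"

lemma norm_complex2: "(norm (v :: complex ^ 2))\<^sup>2 = (cmod (v $ 1))\<^sup>2 + (cmod (v $ 2))\<^sup>2"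
  by (simp add: norm_vec_def L2_set_def sum_2)

lemma sym_matrix_mult_nth:
  "(sym_matrix x *v v) $ 1 = x $ 1 * v $ 1 + x $ 3 * v $ 2"
  "(sym_matrix x *v v) $ 2 = x $ 3 * v $ 1 + x $ 2 * v $ 2"
  by (simp_all add: sym_matrix_def matrix_vector_mult_def sum_2)

lemma bounded_linear_sym_matrix: "bounded_linear (\<lambda>v. sym_matrix x *v v)"
proof -
  have "linear (\<lambda>v. sym_matrix x *v v)"
    by (rule linearI) (auto simp: vec_eq_iff forall_2 sym_matrix_mult_nth algebra_simps)
  then show ?thesis by (simp add: linear_conv_bounded_linear)
qed

text \<open>Completing the square in the Hermitian form with matrix \<open>P = 1 - A\<^sup>* A\<close>, whose entries are
  \<open>P\<^sub>1\<^sub>1 = 1 - |a|\<^sup>2 - |z|\<^sup>2\<close> and \<open>P\<^sub>1\<^sub>2 = - m\<close> and whose determinant is \<open>1 - (|a|\<^sup>2 + |b|\<^sup>2 + 2 |z|\<^sup>2) + |det A|\<^sup>2\<close>.\<close>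

lemma hermitian_complete_square:
  fixes a b z u v :: complex
  defines "p \<equiv> 1 - (cmod a)\<^sup>2 - (cmod z)\<^sup>2" and "m \<equiv> cnj a * z + cnj z * b"
  shows "p * ((cmod u)\<^sup>2 + (cmod v)\<^sup>2 - (cmod (a * u + z * v))\<^sup>2 - (cmod (z * u + b * v))\<^sup>2)
    = (cmod (of_real p * u - m * v))\<^sup>2
      + (1 - ((cmod a)\<^sup>2 + (cmod b)\<^sup>2 + 2 * (cmod z)\<^sup>2) + (cmod (a * b - z\<^sup>2))\<^sup>2) * (cmod v)\<^sup>2"
proof -
  have "complex_of_real (p * ((cmod u)\<^sup>2 + (cmod v)\<^sup>2 - (cmod (a * u + z * v))\<^sup>2 - (cmod (z * u + b * v))\<^sup>2))
    = of_real ((cmod (of_real p * u - m * v))\<^sup>2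
      + (1 - ((cmod a)\<^sup>2 + (cmod b)\<^sup>2 + 2 * (cmod z)\<^sup>2) + (cmod (a * b - z\<^sup>2))\<^sup>2) * (cmod v)\<^sup>2)"
    unfolding p_def m_def
    by (simp add: complex_norm_square del: of_real_power) (simp add: power2_eq_square algebra_simps)
  then show ?thesis by (simp only: of_real_eq_iff)
qed

lemma hermitian_det:
  fixes a b z :: complex
  shows "(1 - (cmod a)\<^sup>2 - (cmod z)\<^sup>2) * (1 - (cmod b)\<^sup>2 - (cmod z)\<^sup>2) - (cmod (cnj a * z + cnj z * b))\<^sup>2
    = 1 - ((cmod a)\<^sup>2 + (cmod b)\<^sup>2 + 2 * (cmod z)\<^sup>2) + (cmod (a * b - z\<^sup>2))\<^sup>2"
proof -
  \<comment> \<open>Read in \<open>complex\<close>, squared moduli become products with conjugates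
    and the claim is a polynomial identity.\<close>
  have "complex_of_real ((1 - (cmod a)\<^sup>2 - (cmod z)\<^sup>2) * (1 - (cmod b)\<^sup>2 - (cmod z)\<^sup>2)
      - (cmod (cnj a * z + cnj z * b))\<^sup>2)
    = of_real (1 - ((cmod a)\<^sup>2 + (cmod b)\<^sup>2 + 2 * (cmod z)\<^sup>2) + (cmod (a * b - z\<^sup>2))\<^sup>2)"
    by (simp add: complex_norm_square del: of_real_power) (simp add: power2_eq_square algebra_simps)
  then show ?thesis by (simp only: of_real_eq_iff)
qed

text \<open>The supremum defining the operator norm is attained on the compact unit sphere, so
  pointwise strict inequality remains strict.\<close>

lemma R_II_iff_contraction:
  "x \<in> R_II \<longleftrightarrow> (\<forall>v. v \<noteq> 0 \<longrightarrow> norm (sym_matrix x *v v) < norm v)"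
proof
  assume "x \<in> R_II"
  then have *: "onorm (\<lambda>v. sym_matrix x *v v) < 1" by (simp add: R_II_def)
  show "\<forall>v. v \<noteq> 0 \<longrightarrow> norm (sym_matrix x *v v) < norm v"
  proof (intro allI impI)
    fix v :: "complex ^ 2" assume "v \<noteq> 0"
    have "norm (sym_matrix x *v v) \<le> onorm (\<lambda>v. sym_matrix x *v v) * norm v"
      by (rule onorm[OF bounded_linear_sym_matrix])
    also have "\<dots> < 1 * norm v" using * \<open>v \<noteq> 0\<close> by (intro mult_strict_right_mono) auto
    finally show "norm (sym_matrix x *v v) < norm v" by simp
  qed
next
  assume contr: "\<forall>v. v \<noteq> 0 \<longrightarrow> norm (sym_matrix x *v v) < norm v"
  interpret bounded_linear "\<lambda>v. sym_matrix x *v v" by (rule bounded_linear_sym_matrix)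
  have "continuous_on (sphere (0 :: complex ^ 2) 1) (\<lambda>v. norm (sym_matrix x *v v))"
    by (intro continuous_intros continuous_on)
  moreover have "sphere (0 :: complex ^ 2) 1 \<noteq> {}" by simp
  ultimately obtain u where u: "u \<in> sphere 0 1"
    "\<And>v. v \<in> sphere 0 1 \<Longrightarrow> norm (sym_matrix x *v v) \<le> norm (sym_matrix x *v u)"
    using continuous_attains_sup[OF compact_sphere] by metis
  have "norm (sym_matrix x *v v) \<le> norm (sym_matrix x *v u) * norm v" for v
  proof (cases "v = 0")
    case True
    then show ?thesis by (simp add: zero)
  next
    case False
    have "norm (sym_matrix x *v ((1 / norm v) *\<^sub>R v)) \<le> norm (sym_matrix x *v u)"
      using False by (intro u(2)) simp
    then show ?thesis using False by (simp add: scaleR field_simps)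
  qed
  then have "onorm (\<lambda>v. sym_matrix x *v v) \<le> norm (sym_matrix x *v u)"
    by (rule onorm_le)
  moreover have "norm (sym_matrix x *v u) < 1"
  proof -
    have "u \<noteq> 0" using u(1) by auto
    then have "norm (sym_matrix x *v u) < norm u" using contr by blast
    then show ?thesis using u(1) by simp
  qed
  ultimately show "x \<in> R_II" by (simp add: R_II_def)
qed

text \<open>A strict contraction \<open>A\<close> is one for which 1 - A^* A is positive definite,
  and a Hermitian matrix of order two is so iff its trace and determinant are positive. The first
  inequality is the trace condition, the second the determinant condition.\<close>

lemma R_II_iff:
  "x \<in> R_II \<longleftrightarrow> R_II_sum x < 2 \<and> R_II_sum x < 1 + (cmod (x $ 1 * x $ 2 - (x $ 3)\<^sup>2))\<^sup>2"
proof -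
  define a b z where "a = x $ 1" and "b = x $ 2" and "z = x $ 3"
  define p q m where "p = 1 - (cmod a)\<^sup>2 - (cmod z)\<^sup>2" and "q = 1 - (cmod b)\<^sup>2 - (cmod z)\<^sup>2"
    and "m = cnj a * z + cnj z * b"
  define d where "d = 1 - R_II_sum x + (cmod (a * b - z\<^sup>2))\<^sup>2"
  have d: "p * q - (cmod m)\<^sup>2 = d"
    using hermitian_det[of a z b] unfolding p_def q_def m_def d_def R_II_sum_def a_def b_def z_def by simp
  have form: "p * ((norm v)\<^sup>2 - (norm (sym_matrix x *v v))\<^sup>2)
      = (cmod (of_real p * v $ 1 - m * v $ 2))\<^sup>2 + d * (cmod (v $ 2))\<^sup>2" for v
    using hermitian_complete_square[of a z "v $ 1" "v $ 2" b]
    unfolding norm_complex2 sym_matrix_mult_nth p_def m_def d_def R_II_sum_def a_def b_def z_def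
    by (simp add: algebra_simps)
  have sum: "R_II_sum x = 2 - p - q" by (simp add: R_II_sum_def p_def q_def a_def b_def z_def)
  have "(\<forall>v. v \<noteq> 0 \<longrightarrow> norm (sym_matrix x *v v) < norm v) \<longleftrightarrow> p + q > 0 \<and> d > 0"
  proof
    assume contr: "\<forall>v. v \<noteq> 0 \<longrightarrow> norm (sym_matrix x *v v) < norm v"
    then have c2: "(norm (sym_matrix x *v v))\<^sup>2 < (norm v)\<^sup>2" if "v \<noteq> 0" for v
      using that by (simp add: power_strict_mono)
    have p: "p > 0"
      using c2[of "vector [1, 0]"] unfolding norm_complex2 sym_matrix_mult_nth
      by (simp add: p_def a_def z_def vec_eq_iff forall_2)
    have q: "q > 0"
      using c2[of "vector [0, 1]"] unfolding norm_complex2 sym_matrix_mult_nth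
      by (simp add: q_def b_def z_def vec_eq_iff forall_2)
    have "0 < p * ((norm v)\<^sup>2 - (norm (sym_matrix x *v v))\<^sup>2)" if "v \<noteq> 0" for v
      using p c2[OF that] by simp
    \<comment> \<open>This vector makes the completed square vanish and isolates the determinant
      \<open>d\<close>.\<close>
    from this[of "vector [m, of_real p]"] have "0 < d * p\<^sup>2"
      unfolding form using p by (simp add: vec_eq_iff forall_2)
    then have "d > 0" using p by (simp add: zero_less_mult_iff)
    then show "p + q > 0 \<and> d > 0" using p q by simp
  next
    assume pq: "p + q > 0 \<and> d > 0"
    have "p * q > 0" using d pq by (smt (verit) zero_le_power2)
    then have p: "p > 0" using pq by (smt (verit) zero_less_mult_iff)
    show "\<forall>v. v \<noteq> 0 \<longrightarrow> norm (sym_matrix x *v v) < norm v"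
    proof (intro allI impI)
      fix v :: "complex ^ 2" assume v: "v \<noteq> 0"
      have "0 < p * ((norm v)\<^sup>2 - (norm (sym_matrix x *v v))\<^sup>2)"
      proof (cases "v $ 2 = 0")
        case True
        then have "v $ 1 \<noteq> 0" using v by (simp add: vec_eq_iff forall_2)
        then show ?thesis unfolding form using True p by simp
      next
        case False
        then show ?thesis unfolding form using pq by (intro add_nonneg_pos) auto
      qed
      then have "(norm (sym_matrix x *v v))\<^sup>2 < (norm v)\<^sup>2" using p by (simp add: zero_less_mult_iff)
      then show "norm (sym_matrix x *v v) < norm v" by (simp add: power_less_imp_less_base)
    qed
  qed
  then show ?thesis
    unfolding R_II_iff_contraction by (auto simp: sum d_def a_def b_def z_def)
qed

text \<open>Both inequalities for \<open>R_II\<close> involve the third coordinate only through its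
  square, which the image point recovers as \<open>x $ 1 * x $ 2 - x $ 3\<close>; either square root
  gives a preimage.\<close>

lemma tetrablock_iff:
  "x \<in> tetrablock \<longleftrightarrow>
    (cmod (x $ 1))\<^sup>2 + (cmod (x $ 2))\<^sup>2 + 2 * cmod (x $ 1 * x $ 2 - x $ 3) < 2 \<and>
    (cmod (x $ 1))\<^sup>2 + (cmod (x $ 2))\<^sup>2 + 2 * cmod (x $ 1 * x $ 2 - x $ 3) < 1 + (cmod (x $ 3))\<^sup>2"
    (is "_ \<longleftrightarrow> ?P x")
proof
  have *: "?P (tetrablock_map y) \<longleftrightarrow> y \<in> R_II" for y
    by (simp add: R_II_iff tetrablock_map_def R_II_sum_def norm_power)
  show "x \<in> tetrablock \<Longrightarrow> ?P x"
    using * by (auto simp: tetrablock_def)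
  assume P: "?P x"
  define y :: "complex ^ 3" where "y = vector [x $ 1, x $ 2, csqrt (x $ 1 * x $ 2 - x $ 3)]"
  have "tetrablock_map y = x" by (simp add: y_def tetrablock_map_def vec_eq_iff forall_3)
  then show "x \<in> tetrablock"
    using *[of y] P unfolding tetrablock_def by (auto intro: image_eqI[of x _ y])
qed

lemma tetrablock_map_in_iff: "tetrablock_map x \<in> tetrablock \<longleftrightarrow> x \<in> R_II"
  by (simp add: R_II_iff tetrablock_iff tetrablock_map_def R_II_sum_def norm_power)

section \<open>Openness, boundedness and circularity of the domains\<close>

lemma open_R_II: "open R_II"
proof -
  have eq: "R_II = {x. R_II_sum x < 2} \<inter> {x. R_II_sum x < 1 + (cmod (x $ 1 * x $ 2 - (x $ 3)\<^sup>2))\<^sup>2}"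
    by (auto simp: R_II_iff)
  show ?thesis
    unfolding eq R_II_sum_def by (intro open_Int open_Collect_less continuous_intros)
qed

lemma open_tetrablock: "open tetrablock"
proof -
  have eq: "tetrablock = {x. (cmod (x $ 1))\<^sup>2 + (cmod (x $ 2))\<^sup>2 + 2 * cmod (x $ 1 * x $ 2 - x $ 3) < 2} \<inter>
    {x. (cmod (x $ 1))\<^sup>2 + (cmod (x $ 2))\<^sup>2 + 2 * cmod (x $ 1 * x $ 2 - x $ 3) < 1 + (cmod (x $ 3))\<^sup>2}"
    by (auto simp: tetrablock_iff)
  show ?thesis
    unfolding eq by (intro open_Int open_Collect_less continuous_intros)
qed

lemma bounded_R_II: "bounded R_II"
  unfolding bounded_iff
proof (intro exI ballI)
  fix x assume "x \<in> R_II"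
  then have "R_II_sum x < 2" by (simp add: R_II_iff)
  moreover have "(norm x)\<^sup>2 = R_II_sum x - (cmod (x $ 3))\<^sup>2"
    by (simp add: R_II_sum_def norm_vec_def L2_set_def sum_3)
  ultimately have "(norm x)\<^sup>2 \<le> 4"
    using zero_le_power2[of "cmod (x $ 3)"] by linarith
  then show "norm x \<le> 2" using power2_le_imp_le[of "norm x" 2] by simp
qed

lemma R_II_circular:
  assumes "x \<in> R_II" "cmod c \<le> 1"
  shows "c *s x \<in> R_II"
  unfolding R_II_iff_contraction
proof (intro allI impI)
  fix v :: "complex ^ 2" assume v: "v \<noteq> 0"
  have "sym_matrix (c *s x) *v v = c *s (sym_matrix x *v v)"
    by (simp add: vec_eq_iff forall_2 sym_matrix_mult_nth algebra_simps)
  then have "norm (sym_matrix (c *s x) *v v) = cmod c * norm (sym_matrix x *v v)"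
    by (simp add: norm_smult_vec)
  also have "\<dots> \<le> 1 * norm (sym_matrix x *v v)" using assms(2) by (intro mult_right_mono) auto
  also have "\<dots> < norm v" using assms(1) v by (simp add: R_II_iff_contraction)
  finally show "norm (sym_matrix (c *s x) *v v) < norm v" .
qed

section \<open>Moebius transformations of the swapped matrix\<close>

definition swap_den :: "real \<Rightarrow> complex ^ 3 \<Rightarrow> complex"
  where "swap_den w x = (1 + of_real w * x $ 3)\<^sup>2 - (of_real w)\<^sup>2 * x $ 1 * x $ 2"

text \<open>The matrix (X + w) (1 + w X)^-1 written in coordinates, where X = [[x$3, x$2],
  [x$1, x$3]]; \<open>swap_den w x\<close> is the determinant of 1 + w X. The origin goes to (0, 0,
  w).\<close>

definition swap_moebius :: "real \<Rightarrow> complex ^ 3 \<Rightarrow> complex ^ 3"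
  where "swap_moebius w x = vector
    [of_real (1 - w\<^sup>2) * x $ 1 / swap_den w x, of_real (1 - w\<^sup>2) * x $ 2 / swap_den w x,
     ((x $ 3 + of_real w) * (1 + of_real w * x $ 3) - of_real w * x $ 1 * x $ 2) / swap_den w x]"

text \<open>The two numbers \<open>l\<close>, \<open>m\<close> are the eigenvalues of \<open>[[x$3, x$2], [x$1, x$3]]\<close>; a Moebius
  transformation of this matrix acts on them separately.\<close>

lemma R_II_iff_eigenvalues:
  fixes x :: "complex ^ 3"
  assumes lm: "l + m = 2 * x $ 3" "l * m = (x $ 3)\<^sup>2 - x $ 1 * x $ 2"
  shows "x \<in> R_II \<longleftrightarrow> cmod l < 1 \<and> cmod m < 1 \<and>
    (cmod (x $ 1) - cmod (x $ 2))\<^sup>2 < (1 - (cmod l)\<^sup>2) * (1 - (cmod m)\<^sup>2)"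
proof -
  define p q e where "p = (cmod l)\<^sup>2" and "q = (cmod m)\<^sup>2" and "e = (cmod (x $ 1) - cmod (x $ 2))\<^sup>2"
  have "(l - m)\<^sup>2 = 4 * (x $ 1 * x $ 2)"
  proof -
    have "(l - m)\<^sup>2 = (l + m)\<^sup>2 - 4 * (l * m)" by (simp add: power2_eq_square algebra_simps)
    then show ?thesis unfolding lm by (simp add: power2_eq_square)
  qed
  then have "(cmod (l - m))\<^sup>2 = 4 * (cmod (x $ 1) * cmod (x $ 2))"
    by (metis norm_mult norm_numeral norm_power)
  moreover have "(cmod (l + m))\<^sup>2 = 4 * (cmod (x $ 3))\<^sup>2"
    unfolding lm by (simp add: norm_mult power_mult_distrib)
  moreover have "(cmod (l + m))\<^sup>2 + (cmod (l - m))\<^sup>2 = 2 * p + 2 * q"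
    unfolding p_def q_def cmod_power2 by (simp add: power2_eq_square algebra_simps)
  \<comment> \<open>\<open>R_II_sum\<close> is the squared Frobenius norm; its excess
    \<open>e\<close> over the sum of the squared eigenvalue moduli measures the failure of
    normality.\<close>
  ultimately have S: "R_II_sum x = p + q + e"
    by (simp add: R_II_sum_def e_def power2_diff)
  have "cmod (x $ 1 * x $ 2 - (x $ 3)\<^sup>2) = cmod (l * m)"
    unfolding lm by (rule norm_minus_commute)
  then have D: "(cmod (x $ 1 * x $ 2 - (x $ 3)\<^sup>2))\<^sup>2 = p * q"
    by (simp add: p_def q_def norm_mult power_mult_distrib)
  have nn: "p \<ge> 0" "q \<ge> 0" "e \<ge> 0" by (simp_all add: p_def q_def e_def)
  have "p + q + e < 2 \<and> p + q + e < 1 + p * q \<longleftrightarrow> p < 1 \<and> q < 1 \<and> e < (1 - p) * (1 - q)"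
  proof
    assume A: "p + q + e < 2 \<and> p + q + e < 1 + p * q"
    then have "(1 - p) * (1 - q) > 0" "(1 - p) + (1 - q) > 0" using nn by (auto simp: algebra_simps)
    then have "p < 1 \<and> q < 1" by (smt (verit) zero_less_mult_iff)
    then show "p < 1 \<and> q < 1 \<and> e < (1 - p) * (1 - q)" using A by (simp add: algebra_simps)
  next
    assume A: "p < 1 \<and> q < 1 \<and> e < (1 - p) * (1 - q)"
    then have "p * q < 1" using nn by (metis mult_strict_mono' mult_1)
    then show "p + q + e < 2 \<and> p + q + e < 1 + p * q" using A by (simp add: algebra_simps)
  qed
  moreover have "p < 1 \<longleftrightarrow> cmod l < 1" "q < 1 \<longleftrightarrow> cmod m < 1"
    by (simp_all add: p_def q_def power_less_one_iff)
  ultimately show ?thesis unfolding R_II_iff S D e_def p_def q_def by simp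
qed

lemma eigenvalues_exist: "\<exists>l m :: complex. l + m = 2 * s \<and> l * m = s\<^sup>2 - d"
  by (intro exI[of _ "s + csqrt d"] exI[of _ "s - csqrt d"])
    (simp add: square_diff_square_factored[symmetric] flip: power2_eq_square, simp add: algebra_simps flip: power2_eq_square)

lemma swap_den_factor:
  fixes x :: "complex ^ 3"
  assumes "l + m = 2 * x $ 3" "l * m = (x $ 3)\<^sup>2 - x $ 1 * x $ 2"
  shows "swap_den w x = (1 + of_real w * l) * (1 + of_real w * m)"
proof -
  have "(1 + of_real w * l) * (1 + of_real w * m) = 1 + of_real w * (l + m) + (of_real w)\<^sup>2 * (l * m)"
    by (simp add: power2_eq_square algebra_simps)
  then show ?thesis unfolding assms swap_den_def by (simp add: power2_eq_square algebra_simps)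
qed

text \<open>The eigenvalues \<open>l\<close>, \<open>m\<close> of the swapped matrix lie in the open
  unit disc, so neither factor 1 + w l, 1 + w m can vanish.\<close>

lemma swap_den_nonzero:
  assumes x: "x \<in> R_II" and w: "\<bar>w\<bar> < 1"
  shows "swap_den w x \<noteq> 0"
proof -
  obtain l m where lm: "l + m = 2 * x $ 3" "l * m = (x $ 3)\<^sup>2 - x $ 1 * x $ 2"
    using eigenvalues_exist by blast
  have "1 + of_real w * t \<noteq> 0" if "cmod t < 1" for t
  proof
    assume "1 + of_real w * t = 0"
    then have "cmod (of_real w * t) = 1" by (metis add_eq_0_iff norm_minus_cancel norm_one)
    moreover have "\<bar>w\<bar> * cmod t < 1"
      using w that by (metis abs_ge_zero mult_strict_mono' norm_ge_zero mult_1)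
    ultimately show False by (simp add: norm_mult)
  qed
  then show ?thesis
    using R_II_iff_eigenvalues[OF lm] x by (simp add: swap_den_factor[OF lm])
qed

text \<open>The classical identity for disc automorphisms, to be applied to each eigenvalue.\<close>

lemma one_minus_moebius_norm:
  assumes "1 + of_real w * l \<noteq> 0"
  shows "1 - (cmod ((l + of_real w) / (1 + of_real w * l)))\<^sup>2
    = (1 - w\<^sup>2) * (1 - (cmod l)\<^sup>2) / (cmod (1 + of_real w * l))\<^sup>2"
proof -
  have "(cmod (1 + of_real w * l))\<^sup>2 - (cmod (l + of_real w))\<^sup>2 = (1 - w\<^sup>2) * (1 - (cmod l)\<^sup>2)"
    unfolding cmod_power2 by (simp add: power2_eq_square algebra_simps)
  then show ?thesis using assms by (simp add: norm_divide power_divide field_simps)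
qed

text \<open>The eigenvalues move by a disc automorphism and the moduli of the first two coordinates
  are scaled by a common factor \<open>k\<close>, so both sides of the last condition in
  \<open>R_II_iff_eigenvalues\<close> are multiplied by k^2. As \<open>x\<close> may lie outside
  \<open>R_II\<close>, this determines the full preimage needed for substitution with
  indicators.\<close>

lemma swap_moebius_in_R_II_iff:
  assumes den: "swap_den w x \<noteq> 0" and w: "\<bar>w\<bar> < 1"
  shows "swap_moebius w x \<in> R_II \<longleftrightarrow> x \<in> R_II"
proof -
  obtain l m where lm: "l + m = 2 * x $ 3" "l * m = (x $ 3)\<^sup>2 - x $ 1 * x $ 2"
    using eigenvalues_exist by blast
  have x12: "x $ 1 * x $ 2 = (x $ 3)\<^sup>2 - l * m" and x3: "x $ 3 = (l + m) / 2"
    using lm by simp_all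
  define c where "c = complex_of_real w"
  define P Q where "P = 1 + c * l" and "Q = 1 + c * m"
  have dPQ: "swap_den w x = P * Q" unfolding P_def Q_def c_def by (rule swap_den_factor[OF lm])
  then have nz: "P \<noteq> 0" "Q \<noteq> 0" using den by auto
  define l' m' where "l' = (l + c) / P" and "m' = (m + c) / Q"
  have "(l + c) * Q + (m + c) * P = 2 * ((x $ 3 + c) * (1 + c * x $ 3) - c * (x $ 1 * x $ 2))"
    unfolding x12 x3 P_def Q_def by (simp add: field_simps power2_eq_square)
  then have sum: "l' + m' = 2 * swap_moebius w x $ 3"
    using nz by (simp add: swap_moebius_def dPQ l'_def m'_def field_simps c_def)
  have prod: "l' * m' = (swap_moebius w x $ 3)\<^sup>2 - swap_moebius w x $ 1 * swap_moebius w x $ 2"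
  proof -
    define N where "N = (x $ 3 + c) * (1 + c * x $ 3) - c * (x $ 1 * x $ 2)"
    have "(l + c) * (m + c) * (P * Q)
        = ((x $ 3 + c) * (1 + c * x $ 3) - c * (x $ 1 * x $ 2))\<^sup>2 - (1 - c\<^sup>2)\<^sup>2 * (x $ 1 * x $ 2)"
      unfolding x12 x3 P_def Q_def by (simp add: field_simps power2_eq_square)
    then have N: "(l + c) * (m + c) * (P * Q) = N\<^sup>2 - (1 - c\<^sup>2)\<^sup>2 * (x $ 1 * x $ 2)"
      unfolding N_def .
    have "l' * m' = (l + c) * (m + c) * (P * Q) / (P * Q)\<^sup>2"
      using nz by (simp add: l'_def m'_def power2_eq_square)
    also have "\<dots> = (N / (P * Q))\<^sup>2 - ((1 - c\<^sup>2) * x $ 1 / (P * Q)) * ((1 - c\<^sup>2) * x $ 2 / (P * Q))"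
      unfolding N by (simp add: diff_divide_distrib power_divide power2_eq_square)
    also have "\<dots> = (swap_moebius w x $ 3)\<^sup>2 - swap_moebius w x $ 1 * swap_moebius w x $ 2"
      by (simp add: swap_moebius_def dPQ c_def N_def mult.assoc)
    finally show ?thesis .
  qed
  define k where "k = (1 - w\<^sup>2) / (cmod P * cmod Q)"
  have w2: "1 - w\<^sup>2 > 0" using w by (simp add: abs_square_less_1)
  have k: "k > 0" using w2 nz by (simp add: k_def)
  have l': "1 - (cmod l')\<^sup>2 = (1 - w\<^sup>2) / (cmod P)\<^sup>2 * (1 - (cmod l)\<^sup>2)"
    using one_minus_moebius_norm[of w l] nz by (simp add: l'_def P_def c_def)
  have m': "1 - (cmod m')\<^sup>2 = (1 - w\<^sup>2) / (cmod Q)\<^sup>2 * (1 - (cmod m)\<^sup>2)"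
    using one_minus_moebius_norm[of w m] nz by (simp add: m'_def Q_def c_def)
  have "cmod l' < 1 \<longleftrightarrow> 1 - (cmod l')\<^sup>2 > 0" "cmod m' < 1 \<longleftrightarrow> 1 - (cmod m')\<^sup>2 > 0"
    "cmod l < 1 \<longleftrightarrow> 1 - (cmod l)\<^sup>2 > 0" "cmod m < 1 \<longleftrightarrow> 1 - (cmod m)\<^sup>2 > 0"
    by (simp_all add: power_less_one_iff)
  moreover have "1 - (cmod l')\<^sup>2 > 0 \<longleftrightarrow> 1 - (cmod l)\<^sup>2 > 0" "1 - (cmod m')\<^sup>2 > 0 \<longleftrightarrow> 1 - (cmod m)\<^sup>2 > 0"
    unfolding l' m' using w2 nz by (simp_all add: zero_less_mult_iff zero_less_divide_iff)
  ultimately have lt: "cmod l' < 1 \<longleftrightarrow> cmod l < 1" "cmod m' < 1 \<longleftrightarrow> cmod m < 1" by simp_all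
  have rhs: "(1 - (cmod l')\<^sup>2) * (1 - (cmod m')\<^sup>2) = k\<^sup>2 * ((1 - (cmod l)\<^sup>2) * (1 - (cmod m)\<^sup>2))"
    unfolding l' m' k_def by (simp add: power2_eq_square mult_ac)
  have "cmod (of_real (1 - w\<^sup>2)) = 1 - w\<^sup>2" using w2 by (simp only: norm_of_real)
  then have n: "cmod (swap_moebius w x $ 1) = k * cmod (x $ 1)" "cmod (swap_moebius w x $ 2) = k * cmod (x $ 2)"
    by (simp_all add: swap_moebius_def dPQ norm_mult norm_divide k_def del: of_real_diff of_real_power)
  have lhs: "(cmod (swap_moebius w x $ 1) - cmod (swap_moebius w x $ 2))\<^sup>2 = k\<^sup>2 * (cmod (x $ 1) - cmod (x $ 2))\<^sup>2"
    unfolding n by (simp add: power_mult_distrib flip: right_diff_distrib)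
  show ?thesis
    unfolding R_II_iff_eigenvalues[OF lm] R_II_iff_eigenvalues[OF sum prod] lt lhs rhs
    using k by simp
qed

subsection \<open>The Bergman kernel of \<open>R_II\<close> on the axis\<close>

text \<open>Tested on indicators, the hypothesis says that the image under \<open>T\<close> of the
  measure with density \<rho> is \<open>lborel\<close>; this carries nonnegative integrals over to
  Bochner integrals.\<close>

lemma lborel_substitution:
  fixes T :: "'a::euclidean_space \<Rightarrow> 'a" and g :: "'a \<Rightarrow> 'b::{banach, second_countable_topology}"
  assumes T [measurable]: "T \<in> borel_measurable borel" and \<rho> [measurable]: "\<rho> \<in> borel_measurable borel"
    and nn: "\<And>x. \<rho> x \<ge> 0"
    and eq: "\<And>f. f \<in> borel_measurable borel \<Longrightarrow> (\<integral>\<^sup>+x. f (T x) * ennreal (\<rho> x) \<partial>lborel) = (\<integral>\<^sup>+x. f x \<partial>lborel)"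
    and g [measurable]: "g \<in> borel_measurable borel"
  shows "integrable lborel (\<lambda>x. \<rho> x *\<^sub>R g (T x)) \<longleftrightarrow> integrable lborel g"
    and "(LINT x|lborel. \<rho> x *\<^sub>R g (T x)) = (LINT x|lborel. g x)"
proof -
  have L: "distr (density lborel \<rho>) borel T = lborel"
  proof (rule measure_eqI)
    fix A assume "A \<in> sets (distr (density lborel \<rho>) borel T)"
    then have [measurable]: "A \<in> sets borel" by simp
    have "T -` A \<in> sets borel" using measurable_sets[OF T, of A] by simp
    then have "emeasure (distr (density lborel \<rho>) borel T) A = (\<integral>\<^sup>+x. indicator A (T x) * ennreal (\<rho> x) \<partial>lborel)"
      by (simp add: emeasure_distr emeasure_density mult.commute indicator_vimage)
    then show "emeasure (distr (density lborel \<rho>) borel T) A = emeasure lborel A"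
      using eq[of "indicator A"] by simp
  qed simp
  have "integrable (distr (density lborel \<rho>) borel T) g \<longleftrightarrow> integrable (density lborel \<rho>) (\<lambda>x. g (T x))"
    by (rule integrable_distr_eq) auto
  also have "\<dots> \<longleftrightarrow> integrable lborel (\<lambda>x. \<rho> x *\<^sub>R g (T x))"
    by (rule integrable_density) (use nn in auto)
  finally show "integrable lborel (\<lambda>x. \<rho> x *\<^sub>R g (T x)) \<longleftrightarrow> integrable lborel g" by (simp add: L)
  have "(LINT x|distr (density lborel \<rho>) borel T. g x) = (LINT x|density lborel \<rho>. g (T x))"
    by (rule integral_distr) auto
  also have "\<dots> = (LINT x|lborel. \<rho> x *\<^sub>R g (T x))"
    by (rule integral_density) (use nn in auto)
  finally show "(LINT x|lborel. \<rho> x *\<^sub>R g (T x)) = (LINT x|lborel. g x)" by (simp add: L)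
qed

lemma swap_den_measurable [measurable]: "swap_den w \<in> borel_measurable borel"
  unfolding swap_den_def[abs_def] by measurable

lemma swap_moebius_measurable [measurable]: "swap_moebius w \<in> borel_measurable borel"
  unfolding swap_moebius_def[abs_def] by measurable

text \<open>Since (X + w) (1 + w X)^-1 = 1/w - ((1 - w^2)/w) (1 + w X)^-1, the map is an inversion
  between two affine maps. Here \<open>e\<close> stands for the identity matrix and \<open>c\<close>
  for the coefficient of the inverse.\<close>

lemma nn_integral_swap_moebius:
  assumes w: "w \<noteq> 0" "\<bar>w\<bar> < 1" and f [measurable]: "f \<in> borel_measurable borel"
  shows "(\<integral>\<^sup>+x. f (swap_moebius w x) * ennreal ((1 - w\<^sup>2) ^ 6 / cmod (swap_den w x) ^ 6) \<partial>lborel) = (\<integral>\<^sup>+x. f x \<partial>lborel)"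
proof -
  define e :: "complex ^ 3" where "e = vector [0, 0, 1]"
  define c where "c = - ((1 - w\<^sup>2) / w)"
  define G where "G y = f ((1 / w) *\<^sub>R e + c *\<^sub>R swap_inv y) * ennreal (1 / cmod (swap_det y) ^ 6)" for y
  have [measurable]: "G \<in> borel_measurable borel" unfolding G_def by measurable
  have w2: "1 - w\<^sup>2 > 0" using w by (simp add: abs_square_less_1)
  have c: "c \<noteq> 0" using w w2 by (simp add: c_def)
  have sc: "(r *\<^sub>R v) $ i = complex_of_real r * v $ i" for r i and v :: "complex ^ 3"
    using vector_scaleR_component[of r v i] by (simp only: scaleR_conv_of_real[of r "v $ i"])
  have det: "swap_det (e + w *\<^sub>R x) = swap_den w x" for x
    by (simp add: swap_det_def swap_den_def e_def sc power2_eq_square algebra_simps del: vector_scaleR_component)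
  have moeb: "(1 / w) *\<^sub>R e + c *\<^sub>R swap_inv (e + w *\<^sub>R x) = swap_moebius w x" if "swap_den w x \<noteq> 0" for x
  proof -
    define W where "W = complex_of_real w"
    have W: "W \<noteq> 0" using w by (simp add: W_def)
    have "(swap_den w x - (1 - W\<^sup>2) * (1 + W * x $ 3)) = W * ((x $ 3 + W) * (1 + W * x $ 3) - W * x $ 1 * x $ 2)"
      by (simp add: swap_den_def W_def power2_eq_square algebra_simps)
    then have "1 / W - (1 - W\<^sup>2) / W * ((1 + W * x $ 3) / swap_den w x)
        = ((x $ 3 + W) * (1 + W * x $ 3) - W * x $ 1 * x $ 2) / swap_den w x"
      using that W by (simp add: divide_simps)
    then show ?thesis
      using that W unfolding swap_inv_def det swap_moebius_def
      by (simp add: vec_eq_iff forall_3 e_def c_def sc W_def[symmetric] mult.commute[of "swap_den w x" W] del: vector_scaleR_component)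
  qed
  \<comment> \<open>Where the denominator vanishes, both weights are 0 by the division
    convention.\<close>
  have pointwise: "f (swap_moebius w x) * ennreal ((1 - w\<^sup>2) ^ 6 / cmod (swap_den w x) ^ 6)
      = ennreal ((1 - w\<^sup>2) ^ 6) * G (e + w *\<^sub>R x)" for x
    using w2 moeb[of x] by (cases "swap_den w x = 0")
      (auto simp: G_def det mult_ac divide_inverse ennreal_mult' norm_power)
  have "(\<integral>\<^sup>+x. f (swap_moebius w x) * ennreal ((1 - w\<^sup>2) ^ 6 / cmod (swap_den w x) ^ 6) \<partial>lborel)
      = ennreal ((1 - w\<^sup>2) ^ 6) * (\<integral>\<^sup>+x. G (e + w *\<^sub>R x) \<partial>lborel)"
    unfolding pointwise by (rule nn_integral_cmult) simp
  also have "ennreal ((1 - w\<^sup>2) ^ 6) = ennreal (\<bar>c\<bar> ^ 6) * ennreal (\<bar>w\<bar> ^ 6)"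
    using w w2 by (simp add: c_def power_divide flip: ennreal_mult')
  also have "ennreal (\<bar>c\<bar> ^ 6) * ennreal (\<bar>w\<bar> ^ 6) * (\<integral>\<^sup>+x. G (e + w *\<^sub>R x) \<partial>lborel)
      = ennreal (\<bar>c\<bar> ^ 6) * (\<integral>\<^sup>+y. G y \<partial>lborel)"
    using nn_integral_affine_euclidean[of w G e] w by (simp add: mult.assoc)
  also have "(\<integral>\<^sup>+y. G y \<partial>lborel) = (\<integral>\<^sup>+y. f ((1 / w) *\<^sub>R e + c *\<^sub>R y) \<partial>lborel)"
    unfolding G_def by (rule nn_integral_swap_inv) measurable
  also have "ennreal (\<bar>c\<bar> ^ 6) * (\<integral>\<^sup>+y. f ((1 / w) *\<^sub>R e + c *\<^sub>R y) \<partial>lborel) = (\<integral>\<^sup>+x. f x \<partial>lborel)"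
    using nn_integral_affine_euclidean[of c f "(1 / w) *\<^sub>R e"] c by simp
  finally show ?thesis .
qed

lemma nn_integral_tetrablock_map':
  assumes "f \<in> borel_measurable borel"
  shows "(\<integral>\<^sup>+x. f (tetrablock_map x) * ennreal (2 * (cmod (x $ 3))\<^sup>2) \<partial>lborel) = (\<integral>\<^sup>+x. f x \<partial>lborel)"
proof -
  note [measurable] = assms
  have "ennreal (4 * (cmod (x $ 3))\<^sup>2) = 2 * ennreal (2 * (cmod (x $ 3))\<^sup>2)" for x :: "complex ^ 3"
    using ennreal_mult'[of 2 "2 * (cmod (x $ 3))\<^sup>2"] by simp
  then have "2 * (\<integral>\<^sup>+x. f (tetrablock_map x) * ennreal (2 * (cmod (x $ 3))\<^sup>2) \<partial>lborel) = 2 * (\<integral>\<^sup>+x. f x \<partial>lborel)"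
    unfolding nn_integral_tetrablock_map[OF assms, symmetric]
    by (subst nn_integral_cmult[symmetric]) (auto simp: mult_ac)
  then show ?thesis by (simp add: ennreal_mult_cancel_left)
qed

lemma cdiff_compose:
  fixes \<gamma> :: "complex ^ 'm \<Rightarrow> complex ^ 'n"
  assumes f: "cdiff f (\<gamma> z)" and \<gamma>: "\<And>i. cdiff (\<lambda>z. \<gamma> z $ i) z"
  shows "cdiff (\<lambda>z. f (\<gamma> z)) z"
proof -
  obtain D where D: "(f has_derivative D) (at (\<gamma> z))" "\<And>c v. D (c *s v) = c * D v"
    using f unfolding cdiff_def by blast
  obtain E where E: "\<And>i. ((\<lambda>z. \<gamma> z $ i) has_derivative E i) (at z)" "\<And>i c v. E i (c *s v) = c * E i v"
    using \<gamma> unfolding cdiff_def by metis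
  have sum: "(\<Sum>i\<in>UNIV. axis i (x i)) = (\<chi> i. x i)" for x :: "'n \<Rightarrow> complex"
    by (simp add: vec_eq_iff axis_def sum.delta if_distrib cong: if_cong)
  have ax: "bounded_linear (axis i :: complex \<Rightarrow> complex ^ 'n)" for i
    by (intro linear_conv_bounded_linear[THEN iffD1] linearI) (auto simp: vec_eq_iff axis_def)
  have "((\<lambda>z. \<Sum>i\<in>UNIV. axis i (\<gamma> z $ i)) has_derivative (\<lambda>h. \<Sum>i\<in>UNIV. axis i (E i h))) (at z)"
    by (intro has_derivative_sum bounded_linear.has_derivative[OF ax] E)
  then have "(\<gamma> has_derivative (\<lambda>h. \<chi> i. E i h)) (at z)"
    unfolding sum by simp
  from has_derivative_compose[OF this D(1)]
  have "((\<lambda>z. f (\<gamma> z)) has_derivative (\<lambda>h. D (\<chi> i. E i h))) (at z)" .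
  moreover have "D (\<chi> i. E i (c *s v)) = c * D (\<chi> i. E i v)" for c v
  proof -
    have "(\<chi> i. E i (c *s v)) = c *s (\<chi> i. E i v)" by (simp add: vec_eq_iff E)
    then show ?thesis by (simp add: D)
  qed
  ultimately show ?thesis unfolding cdiff_def by blast
qed

lemma cdiff_vector_3_nth:
  assumes "cdiff f z" "cdiff g z" "cdiff h z"
  shows "cdiff (\<lambda>z. (vector [f z, g z, h z] :: complex ^ 3) $ i) z"
  using assms exhaust_3[of i] by auto

lemma cdiff_swap_den: "cdiff (swap_den w) x"
  unfolding swap_den_def[abs_def] by (intro cdiff_diff cdiff_power cdiff_add cdiff_mult cdiff_const cdiff_nth)

lemma cdiff_swap_moebius:
  assumes "swap_den w x \<noteq> 0"
  shows "cdiff (\<lambda>x. swap_moebius w x $ i) x"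
  unfolding swap_moebius_def
  by (intro cdiff_vector_3_nth cdiff_divide cdiff_diff cdiff_add cdiff_mult cdiff_const cdiff_nth
      cdiff_swap_den assms)

lemma cdiff_tetrablock_map: "cdiff (\<lambda>x. tetrablock_map x $ i) x"
  unfolding tetrablock_map_def
  by (intro cdiff_vector_3_nth cdiff_diff cdiff_mult cdiff_power cdiff_const cdiff_nth)

lemma R_II_borel [measurable]: "R_II \<in> sets borel"
  using open_R_II by simp

lemma R_II_measure: "emeasure lborel R_II < \<infinity>" "measure lborel R_II > 0"
proof -
  show fin: "emeasure lborel R_II < \<infinity>"
    by (rule emeasure_bounded_finite[OF bounded_R_II])
  have "0 \<in> R_II" by (simp add: R_II_iff R_II_sum_def)
  then obtain r where "r > 0" "ball 0 r \<subseteq> R_II" using open_R_II open_contains_ball by blast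
  then have "0 < measure lborel (ball (0 :: complex ^ 3) r)"
    by (simp add: content_ball_pos)
  moreover have "measure lborel (ball (0 :: complex ^ 3) r) \<le> measure lborel R_II"
    by (rule measure_mono_fmeasurable) (use fin \<open>ball 0 r \<subseteq> R_II\<close> in \<open>auto simp: fmeasurable_def\<close>)
  ultimately show "measure lborel R_II > 0" by linarith
qed

definition R_II_kernel :: "real \<Rightarrow> complex ^ 3 \<Rightarrow> complex"
  where "R_II_kernel w x = 1 / swap_den (- w) x ^ 3"

context
  fixes w :: real
  assumes w: "w \<noteq> 0" "\<bar>w\<bar> < 1"
begin

lemma moebius_substitution:
  fixes g :: "complex ^ 3 \<Rightarrow> 'b::{banach, second_countable_topology}"
  assumes "(\<lambda>x. indicator R_II x *\<^sub>R g x) \<in> borel_measurable borel"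
  shows "set_integrable lborel R_II (\<lambda>x. ((1 - w\<^sup>2) ^ 6 / cmod (swap_den w x) ^ 6) *\<^sub>R g (swap_moebius w x))
      \<longleftrightarrow> set_integrable lborel R_II g"
    and "(LINT x:R_II|lborel. ((1 - w\<^sup>2) ^ 6 / cmod (swap_den w x) ^ 6) *\<^sub>R g (swap_moebius w x))
      = (LINT x:R_II|lborel. g x)"
proof -
  let ?\<rho> = "\<lambda>x. (1 - w\<^sup>2) ^ 6 / cmod (swap_den w x) ^ 6"
  have "1 - w\<^sup>2 > 0" using w by (simp add: abs_square_less_1)
  then have nn: "?\<rho> x \<ge> 0" for x by simp
  \<comment> \<open>Where the denominator vanishes, the weight is 0 on both sides; elsewhere
    membership in \<open>R_II\<close> is invariant.\<close>
  have eq: "?\<rho> x *\<^sub>R (indicator R_II (swap_moebius w x) *\<^sub>R g (swap_moebius w x))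
      = indicator R_II x *\<^sub>R (?\<rho> x *\<^sub>R g (swap_moebius w x))" for x
    using swap_moebius_in_R_II_iff[of w x] w by (cases "swap_den w x = 0") (auto simp: indicator_def)
  note * = lborel_substitution[OF swap_moebius_measurable _ nn nn_integral_swap_moebius[OF w] assms, unfolded eq]
  show "set_integrable lborel R_II (\<lambda>x. ?\<rho> x *\<^sub>R g (swap_moebius w x)) \<longleftrightarrow> set_integrable lborel R_II g"
    unfolding set_integrable_def by (rule *(1)) auto
  show "(LINT x:R_II|lborel. ?\<rho> x *\<^sub>R g (swap_moebius w x)) = (LINT x:R_II|lborel. g x)"
    unfolding set_lebesgue_integral_def by (rule *(2)) auto
qed

text \<open>The squared modulus of this kernel is a constant times the Jacobian weight, so its
  integrability is the change of variables for the constant 1 on a set of finite volume.\<close>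

lemma R_II_kernel_in_bergman_space: "R_II_kernel (- w) \<in> bergman_space R_II"
proof -
  have "1 - w\<^sup>2 > 0" using w by (simp add: abs_square_less_1)
  have "set_integrable lborel R_II (\<lambda>x. 1 :: real)"
    using R_II_measure(1) by (simp add: set_integrable_def)
  then have "set_integrable lborel R_II (\<lambda>x. ((1 - w\<^sup>2) ^ 6 / cmod (swap_den w x) ^ 6) *\<^sub>R (1 :: real))"
    by (subst moebius_substitution(1)) auto
  then have "set_integrable lborel R_II (\<lambda>x. (1 / (1 - w\<^sup>2) ^ 6) * (((1 - w\<^sup>2) ^ 6 / cmod (swap_den w x) ^ 6) *\<^sub>R (1 :: real)))"
    by (rule set_integrable_mult_right)
  also have "(\<lambda>x. (1 / (1 - w\<^sup>2) ^ 6) * (((1 - w\<^sup>2) ^ 6 / cmod (swap_den w x) ^ 6) *\<^sub>R (1 :: real)))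
      = (\<lambda>x. (cmod (R_II_kernel (- w) x))\<^sup>2)"
    using \<open>1 - w\<^sup>2 > 0\<close> by (auto simp: R_II_kernel_def norm_divide norm_power power_divide simp flip: power_mult)
  finally show ?thesis
    using swap_den_nonzero[OF _ w(2)] unfolding bergman_space_def holomorphic_on_vec_iff R_II_kernel_def
    by (auto intro!: cdiff_divide cdiff_power cdiff_const cdiff_swap_den)
qed

end

text \<open>The determinant of the matrix identity 1 - w (X + w) (1 + w X)^-1 = (1 - w^2) (1 + w
  X)^-1.\<close>

lemma swap_den_moebius:
  assumes "swap_den w x \<noteq> 0"
  shows "swap_den (- w) (swap_moebius w x) = (of_real (1 - w\<^sup>2))\<^sup>2 / swap_den w x"
proof -
  define W where "W = complex_of_real w"
  define d where "d = swap_den w x"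
  have d: "d \<noteq> 0" using assms by (simp add: d_def)
  define N where "N = (x $ 3 + W) * (1 + W * x $ 3) - W * x $ 1 * x $ 2"
  have dN: "d - W * N = (1 - W\<^sup>2) * (1 + W * x $ 3)"
    unfolding d_def N_def swap_den_def W_def by (simp add: power2_eq_square algebra_simps)
  have dd: "d = (1 + W * x $ 3)\<^sup>2 - W\<^sup>2 * (x $ 1 * x $ 2)"
    unfolding d_def swap_den_def W_def by (simp add: mult.assoc)
  have factor: "(k * p / d)\<^sup>2 - V * (k * a / d) * (k * b / d) = k\<^sup>2 * (p\<^sup>2 - V * (a * b)) / d\<^sup>2" for k p V a b
    by (simp add: power2_eq_square diff_divide_distrib algebra_simps)
  have "swap_den (- w) (swap_moebius w x)
      = (1 - W * (N / d))\<^sup>2 - W\<^sup>2 * ((1 - W\<^sup>2) * x $ 1 / d) * ((1 - W\<^sup>2) * x $ 2 / d)"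
    unfolding swap_den_def[of "- w"] swap_moebius_def d_def[symmetric] by (simp add: W_def N_def)
  also have "1 - W * (N / d) = (d - W * N) / d" using d by (simp add: diff_divide_distrib)
  also have "((d - W * N) / d)\<^sup>2 - W\<^sup>2 * ((1 - W\<^sup>2) * x $ 1 / d) * ((1 - W\<^sup>2) * x $ 2 / d)
      = (1 - W\<^sup>2)\<^sup>2 * ((1 + W * x $ 3)\<^sup>2 - W\<^sup>2 * (x $ 1 * x $ 2)) / d\<^sup>2"
    unfolding dN by (rule factor)
  also have "\<dots> = (1 - W\<^sup>2)\<^sup>2 / d" unfolding dd[symmetric] using d by (simp add: power2_eq_square)
  finally show ?thesis by (simp add: W_def d_def)
qed

text \<open>With d = \<open>swap_den w x\<close>, pulling back turns the conjugated kernel into (cnj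
  d)^3 / (1 - w^2)^6, which cancels the antiholomorphic half of the Jacobian. The remaining
  integrand \<open>G\<close> is holomorphic and the mean value property evaluates it at the origin,
  which maps to (0, 0, w).\<close>

lemma R_II_reproducing:
  fixes F :: "complex ^ 3 \<Rightarrow> complex"
  assumes w: "w \<noteq> 0" "\<bar>w\<bar> < 1" and F: "F \<in> bergman_space R_II"
  shows "bergman_inner R_II F (R_II_kernel w) = measure lborel R_II * F (vector [0, 0, of_real w])"
proof -
  have "R_II_kernel w \<in> bergman_space R_II" using R_II_kernel_in_bergman_space[of "- w"] w by simp
  note int = bergman_inner_integrable[OF open_R_II F this]
  have meas: "(\<lambda>x. indicator R_II x *\<^sub>R (F x * cnj (R_II_kernel w x))) \<in> borel_measurable borel"
    using int unfolding set_integrable_def by auto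
  define G where "G x = F (swap_moebius w x) / swap_den w x ^ 3" for x
  have "1 - w\<^sup>2 > 0" using w by (simp add: abs_square_less_1)
  have eq: "((1 - w\<^sup>2) ^ 6 / cmod (swap_den w x) ^ 6) *\<^sub>R (F (swap_moebius w x) * cnj (R_II_kernel w (swap_moebius w x)))
      = G x" if "x \<in> R_II" for x
  proof -
    define d where "d = swap_den w x"
    have d: "d \<noteq> 0" unfolding d_def using swap_den_nonzero[OF that w(2)] .
    define u where "u = complex_of_real (1 - w\<^sup>2)"
    have u: "u \<noteq> 0" using \<open>1 - w\<^sup>2 > 0\<close> unfolding u_def by (simp only: of_real_eq_0_iff)
    have "complex_of_real (cmod d ^ 6) = (of_real ((cmod d)\<^sup>2)) ^ 3" by (simp flip: power_mult)
    also have "\<dots> = (d * cnj d) ^ 3" by (simp only: complex_norm_square)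
    finally have cd: "complex_of_real (cmod d ^ 6) = (d * cnj d) ^ 3" .
    have "complex_of_real ((1 - w\<^sup>2) ^ 6 / cmod d ^ 6) = u ^ 6 / (d * cnj d) ^ 3"
      unfolding of_real_divide cd by (simp add: u_def)
    note m1 = this
    have m2: "cnj (R_II_kernel w (swap_moebius w x)) = (cnj d) ^ 3 / u ^ 6"
      unfolding R_II_kernel_def swap_den_moebius[OF d[unfolded d_def]] d_def[symmetric] u_def[symmetric]
      by (simp add: power_divide u_def flip: power_mult)
    have "((1 - w\<^sup>2) ^ 6 / cmod d ^ 6) *\<^sub>R (F (swap_moebius w x) * cnj (R_II_kernel w (swap_moebius w x)))
        = u ^ 6 / (d * cnj d) ^ 3 * (F (swap_moebius w x) * ((cnj d) ^ 3 / u ^ 6))"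
      by (simp only: scaleR_conv_of_real m1 m2)
    also have "\<dots> = G x"
      unfolding G_def d_def[symmetric] using d u by (simp add: power_mult_distrib)
    finally show ?thesis by (simp only: d_def)
  qed
  have cd: "cdiff G x" if x: "x \<in> R_II" for x
  proof -
    have nz: "swap_den w x \<noteq> 0" using swap_den_nonzero[OF x w(2)] .
    have "swap_moebius w x \<in> R_II" using swap_moebius_in_R_II_iff[OF nz w(2)] x by simp
    then have "cdiff F (swap_moebius w x)" using F by (simp add: bergman_space_def holomorphic_on_vec_iff)
    then have "cdiff (\<lambda>x. F (swap_moebius w x)) x"
      by (rule cdiff_compose) (rule cdiff_swap_moebius[OF nz])
    then show ?thesis
      unfolding G_def[abs_def] by (rule cdiff_divide) (use nz in \<open>auto intro: cdiff_swap_den\<close>)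
  qed
  have cong: "indicator R_II x *\<^sub>R (((1 - w\<^sup>2) ^ 6 / cmod (swap_den w x) ^ 6) *\<^sub>R
      (F (swap_moebius w x) * cnj (R_II_kernel w (swap_moebius w x)))) = indicator R_II x *\<^sub>R G x" for x
    using eq by (auto simp: indicator_def)
  have "bergman_inner R_II F (R_II_kernel w) = (LINT x:R_II|lborel. ((1 - w\<^sup>2) ^ 6 / cmod (swap_den w x) ^ 6) *\<^sub>R
      (F (swap_moebius w x) * cnj (R_II_kernel w (swap_moebius w x))))"
    unfolding bergman_inner_def by (rule moebius_substitution(2)[OF w meas, symmetric])
  also have "\<dots> = (LINT x:R_II|lborel. G x)"
    unfolding set_lebesgue_integral_def cong ..
  also have "\<dots> = measure lborel R_II * G 0"
  proof (rule circular_mean_value[OF open_R_II R_II_circular])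
    show "continuous_on R_II G"
      using cd by (intro holomorphic_on_vec_imp_continuous_on) (simp add: holomorphic_on_vec_iff)
    show "(\<lambda>c. G (c *s v)) holomorphic_on ball 0 1" if v: "v \<in> R_II" for v
    proof -
      have "(\<lambda>c. G (c *s v)) field_differentiable (at c)" if "c \<in> ball 0 1" for c
      proof (rule cdiff_along_curve_field_differentiable)
        show "cdiff G (c *s v)" using that by (intro cd R_II_circular v) auto
      qed (auto intro!: derivative_intros)
      then show ?thesis unfolding holomorphic_on_def using field_differentiable_at_within by blast
    qed
    show "set_integrable lborel R_II G"
      using int moebius_substitution(1)[OF w meas] unfolding set_integrable_def cong by simp
  qed
  also have "G 0 = F (vector [0, 0, of_real w])"
    by (simp add: G_def swap_den_def swap_moebius_def)
  finally show ?thesis .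
qed

subsection \<open>The Bergman kernel of the tetrablock on the axis\<close>

definition tetrablock_lift :: "(complex ^ 3 \<Rightarrow> complex) \<Rightarrow> complex ^ 3 \<Rightarrow> complex"
  where "tetrablock_lift f x = 2 * x $ 3 * f (tetrablock_map x)"

lemma tetrablock_substitution:
  fixes g :: "complex ^ 3 \<Rightarrow> 'b::{banach, second_countable_topology}"
  assumes "(\<lambda>x. indicator tetrablock x *\<^sub>R g x) \<in> borel_measurable borel"
  shows "set_integrable lborel R_II (\<lambda>x. (2 * (cmod (x $ 3))\<^sup>2) *\<^sub>R g (tetrablock_map x))
      \<longleftrightarrow> set_integrable lborel tetrablock g"
    and "(LINT x:R_II|lborel. (2 * (cmod (x $ 3))\<^sup>2) *\<^sub>R g (tetrablock_map x))
      = (LINT x:tetrablock|lborel. g x)"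
proof -
  let ?\<rho> = "\<lambda>x :: complex ^ 3. 2 * (cmod (x $ 3))\<^sup>2"
  have nn: "?\<rho> x \<ge> 0" for x by simp
  have eq: "?\<rho> x *\<^sub>R (indicator tetrablock (tetrablock_map x) *\<^sub>R g (tetrablock_map x))
      = indicator R_II x *\<^sub>R (?\<rho> x *\<^sub>R g (tetrablock_map x))" for x
    using tetrablock_map_in_iff[of x] by (auto simp: indicator_def)
  note * = lborel_substitution[OF tetrablock_map_measurable _ nn nn_integral_tetrablock_map' assms, unfolded eq]
  show "set_integrable lborel R_II (\<lambda>x. ?\<rho> x *\<^sub>R g (tetrablock_map x)) \<longleftrightarrow> set_integrable lborel tetrablock g"
    unfolding set_integrable_def by (rule *(1)) auto
  show "(LINT x:R_II|lborel. ?\<rho> x *\<^sub>R g (tetrablock_map x)) = (LINT x:tetrablock|lborel. g x)"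
    unfolding set_lebesgue_integral_def by (rule *(2)) auto
qed

lemma holomorphic_square_measurable:
  assumes "open \<Omega>" "holomorphic_on_vec f \<Omega>"
  shows "(\<lambda>x. indicator \<Omega> x *\<^sub>R (norm (f x))\<^sup>2) \<in> borel_measurable borel"
  using assms holomorphic_on_vec_imp_continuous_on
  by (intro borel_measurable_continuous_on_indicator continuous_intros) auto

lemma holomorphic_tetrablock_lift:
  assumes f: "holomorphic_on_vec f tetrablock"
  shows "holomorphic_on_vec (tetrablock_lift f) R_II"
  unfolding holomorphic_on_vec_iff
proof
  fix x assume "x \<in> R_II"
  then have "cdiff f (tetrablock_map x)"
    using f by (simp add: holomorphic_on_vec_iff tetrablock_map_in_iff)
  then have "cdiff (\<lambda>x. f (tetrablock_map x)) x"
    by (rule cdiff_compose) (rule cdiff_tetrablock_map)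
  then show "cdiff (tetrablock_lift f) x"
    unfolding tetrablock_lift_def[abs_def] by (intro cdiff_mult cdiff_const cdiff_nth)
qed

lemma tetrablock_lift_in_bergman_space_iff:
  assumes f: "holomorphic_on_vec f tetrablock"
  shows "tetrablock_lift f \<in> bergman_space R_II \<longleftrightarrow> f \<in> bergman_space tetrablock"
proof -
  have sq: "(norm (tetrablock_lift f x))\<^sup>2 = 2 * ((2 * (cmod (x $ 3))\<^sup>2) *\<^sub>R (norm (f (tetrablock_map x)))\<^sup>2)" for x
    by (simp add: tetrablock_lift_def norm_mult power_mult_distrib)
  show ?thesis
    using tetrablock_substitution(1)[OF holomorphic_square_measurable[OF open_tetrablock f]]
      f holomorphic_tetrablock_lift[OF f]
    unfolding bergman_space_def mem_Collect_eq sq by (simp only: set_integrable_mult_right_iff)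
qed

text \<open>The lift contributes |2 z|^2, twice the weight 2 |z|^2 of the substitution, because the
  cover has two sheets.\<close>

lemma bergman_inner_tetrablock_lift:
  assumes f: "f \<in> bergman_space tetrablock" and g: "g \<in> bergman_space tetrablock"
  shows "bergman_inner R_II (tetrablock_lift f) (tetrablock_lift g) = 2 * bergman_inner tetrablock f g"
proof -
  have meas: "(\<lambda>x. indicator tetrablock x *\<^sub>R (f x * cnj (g x))) \<in> borel_measurable borel"
    using bergman_inner_integrable[OF open_tetrablock f g] unfolding set_integrable_def by auto
  have "tetrablock_lift f x * cnj (tetrablock_lift g x)
      = 2 * ((2 * (cmod (x $ 3))\<^sup>2) *\<^sub>R (f (tetrablock_map x) * cnj (g (tetrablock_map x))))" for x
    by (simp add: tetrablock_lift_def scaleR_conv_of_real complex_norm_square del: of_real_power)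
  then show ?thesis
    unfolding bergman_inner_def tetrablock_substitution(2)[OF meas, symmetric]
    by (simp only: set_integral_mult_right)
qed

text \<open>Up to the factor \<open>1 / vol R_II\<close> this is the Bergman kernel of the tetrablock with second
  argument \<open>(0, 0, - w\<^sup>2)\<close>. It is found by antisymmetrizing the kernel \<open>det(1 - Z W\<^sup>*)\<^sup>-\<^sup>3\<close> of \<open>R_II\<close> under
  the deck transformation \<open>z \<mapsto> - z\<close> of the branched double cover.\<close>

definition axis_kernel :: "real \<Rightarrow> complex ^ 3 \<Rightarrow> complex"
  where "axis_kernel w x =
    (3 * (1 - (of_real w)\<^sup>2 * x $ 3)\<^sup>2 + 4 * (of_real w)\<^sup>2 * (x $ 1 * x $ 2 - x $ 3)) /
    ((1 - (of_real w)\<^sup>2 * x $ 3)\<^sup>2 - 4 * (of_real w)\<^sup>2 * (x $ 1 * x $ 2 - x $ 3)) ^ 3"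

text \<open>Shows that \<open>axis_kernel\<close> has no poles on the tetrablock: neither factor
  vanishes on \<open>R_II\<close>.\<close>

lemma axis_kernel_denominator:
  "(1 - (of_real w)\<^sup>2 * tetrablock_map x $ 3)\<^sup>2
      - 4 * (of_real w)\<^sup>2 * (tetrablock_map x $ 1 * tetrablock_map x $ 2 - tetrablock_map x $ 3)
    = swap_den w x * swap_den (- w) x"
  by (simp add: tetrablock_map_def swap_den_def power2_eq_square algebra_simps)

text \<open>The origin of the numerator: (A + B)^3 - (A - B)^3 = 2 B (3 A^2 + B^2). As B = 2 w z,
  the factor 1/(2 w) leaves the 2 z of the lift, and the rest depends on z only through its
  square.\<close>

lemma tetrablock_lift_axis_kernel:
  assumes x: "x \<in> R_II" and w: "w \<noteq> 0" "\<bar>w\<bar> < 1"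
  shows "tetrablock_lift (axis_kernel w) x = (1 / (2 * of_real w)) * (R_II_kernel w x - R_II_kernel (- w) x)"
proof -
  define W where "W = complex_of_real w"
  define A B where "A = 1 - W\<^sup>2 * tetrablock_map x $ 3" and "B = 2 * W * x $ 3"
  have W: "W \<noteq> 0" using w by (simp add: W_def)
  have p: "swap_den w x = A + B" and m: "swap_den (- w) x = A - B"
    by (simp_all add: swap_den_def A_def B_def W_def tetrablock_map_def power2_eq_square algebra_simps)
  have nz: "A + B \<noteq> 0" "A - B \<noteq> 0"
    using swap_den_nonzero[OF x, of w] swap_den_nonzero[OF x, of "- w"] w unfolding p m by simp_all
  have B2: "4 * W\<^sup>2 * (tetrablock_map x $ 1 * tetrablock_map x $ 2 - tetrablock_map x $ 3) = B\<^sup>2"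
    by (simp add: B_def tetrablock_map_def power2_eq_square)
  have AB: "A\<^sup>2 - B\<^sup>2 = (A + B) * (A - B)" by (simp add: power2_eq_square algebra_simps)
  have "tetrablock_lift (axis_kernel w) x = 2 * x $ 3 * ((3 * A\<^sup>2 + B\<^sup>2) / ((A + B) * (A - B)) ^ 3)"
    unfolding tetrablock_lift_def axis_kernel_def W_def[symmetric] B2 A_def[symmetric] AB ..
  also have "\<dots> = 1 / (2 * W) * ((2 * B * (3 * A\<^sup>2 + B\<^sup>2)) / ((A + B) * (A - B)) ^ 3)"
    using W by (simp add: B_def)
  also have "2 * B * (3 * A\<^sup>2 + B\<^sup>2) = (A + B) ^ 3 - (A - B) ^ 3"
    by (simp add: power2_eq_square power3_eq_cube algebra_simps)
  also have "((A + B) ^ 3 - (A - B) ^ 3) / ((A + B) * (A - B)) ^ 3 = 1 / (A - B) ^ 3 - 1 / (A + B) ^ 3"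
    using nz by (simp add: power_mult_distrib diff_divide_distrib)
  finally show ?thesis by (simp add: R_II_kernel_def p m W_def)
qed

text \<open>Pairing a lift with the difference of the kernels at \<open>w\<close> and
  \<open>- w\<close> gives the difference of its values at (0, 0, w) and (0, 0, -w). Lifts are odd
  in z, so the two contributions add up.\<close>

lemma axis_kernel_reproducing:
  fixes f :: "complex ^ 3 \<Rightarrow> complex"
  assumes w: "w \<noteq> 0" "\<bar>w\<bar> < 1"
  shows "axis_kernel w \<in> bergman_space tetrablock"
    and "f \<in> bergman_space tetrablock \<Longrightarrow>
      bergman_inner tetrablock f (axis_kernel w) = measure lborel R_II * f (vector [0, 0, - (of_real w)\<^sup>2])"
proof -
  have hol: "holomorphic_on_vec (axis_kernel w) tetrablock"
    unfolding holomorphic_on_vec_iff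
  proof
    fix x assume "x \<in> tetrablock"
    then obtain y where y: "y \<in> R_II" "x = tetrablock_map y" by (auto simp: tetrablock_def)
    have "swap_den w y * swap_den (- w) y \<noteq> 0"
      using swap_den_nonzero[OF y(1)] w by simp
    then show "cdiff (axis_kernel w) x"
      unfolding axis_kernel_def[abs_def] axis_kernel_denominator[symmetric] y(2)[symmetric]
      by (intro cdiff_divide cdiff_add cdiff_diff cdiff_mult cdiff_power cdiff_const cdiff_nth) simp
  qed
  have K: "R_II_kernel w \<in> bergman_space R_II" "R_II_kernel (- w) \<in> bergman_space R_II"
    using R_II_kernel_in_bergman_space[of w] R_II_kernel_in_bergman_space[of "- w"] w by simp_all
  define c where "c = 1 / (2 * complex_of_real w)"
  have eq: "tetrablock_lift (axis_kernel w) x = c * R_II_kernel w x + (- c) * R_II_kernel (- w) x" if "x \<in> R_II" for x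
    unfolding tetrablock_lift_axis_kernel[OF that w] c_def by (simp add: right_diff_distrib)
  have "(\<lambda>x. c * R_II_kernel w x + (- c) * R_II_kernel (- w) x) \<in> bergman_space R_II"
    by (rule bergman_space_lincomb[OF open_R_II K])
  then have "set_integrable lborel R_II (\<lambda>x. (norm (tetrablock_lift (axis_kernel w) x))\<^sup>2)"
    unfolding bergman_space_def by (auto simp: eq cong: set_integrable_cong)
  then have "tetrablock_lift (axis_kernel w) \<in> bergman_space R_II"
    using holomorphic_tetrablock_lift[OF hol] by (simp add: bergman_space_def)
  then show k: "axis_kernel w \<in> bergman_space tetrablock"
    using tetrablock_lift_in_bergman_space_iff[OF hol] by simp
  assume f: "f \<in> bergman_space tetrablock"
  let ?F = "tetrablock_lift f"
  have F: "?F \<in> bergman_space R_II"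
    using tetrablock_lift_in_bergman_space_iff[of f] f by (simp add: bergman_space_def)
  let ?W = "complex_of_real w" and ?V = "complex_of_real (measure lborel R_II)"
  have "2 * bergman_inner tetrablock f (axis_kernel w) = bergman_inner R_II ?F (tetrablock_lift (axis_kernel w))"
    by (rule bergman_inner_tetrablock_lift[OF f k, symmetric])
  also have "\<dots> = (LINT x:R_II|lborel. c * (?F x * cnj (R_II_kernel w x)) + (- c) * (?F x * cnj (R_II_kernel (- w) x)))"
    unfolding bergman_inner_def
    by (intro set_lebesgue_integral_cong) (auto simp: eq c_def algebra_simps)
  also have "\<dots> = c * bergman_inner R_II ?F (R_II_kernel w) + (- c) * bergman_inner R_II ?F (R_II_kernel (- w))"
    unfolding bergman_inner_def
    by (simp only: set_integral_add(2)[OF set_integrable_mult_right[OF bergman_inner_integrable[OF open_R_II F K(1)]]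
        set_integrable_mult_right[OF bergman_inner_integrable[OF open_R_II F K(2)]]] set_integral_mult_right)
  also have "\<dots> = c * (?V * ?F (vector [0, 0, ?W])) - c * (?V * ?F (vector [0, 0, - ?W]))"
    using R_II_reproducing[OF w F] R_II_reproducing[of "- w" ?F] w F by simp
  \<comment> \<open>The two lifted values are 2 w and -2 w times \<open>f\<close> at the common
    image point; \<open>c\<close> cancels the 2 w, and the 2 that remains is the number of
    sheets.\<close>
  also have "\<dots> = 2 * (?V * f (vector [0, 0, - ?W\<^sup>2]))"
    using w by (simp add: tetrablock_lift_def tetrablock_map_def c_def)
  finally show "bergman_inner tetrablock f (axis_kernel w) = ?V * f (vector [0, 0, - ?W\<^sup>2])" by simp
qed

section \<open>From the reproducing property to \<open>bergman_kernel\<close> and its zero\<close>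

lemma is_bergman_kernel_bergman_kernel:
  fixes \<Omega> :: "(complex ^ 'n) set"
  assumes "open \<Omega>"
  shows "is_bergman_kernel \<Omega> (bergman_kernel \<Omega>)"
proof -
  let ?P = "\<lambda>K. is_bergman_kernel \<Omega> K \<and> (\<forall>z w. z \<notin> \<Omega> \<or> w \<notin> \<Omega> \<longrightarrow> K z w = 0)"
  obtain L where L: "is_bergman_kernel \<Omega> L" using bergman_kernel_exists[OF assms] by blast
  \<comment> \<open>Truncation meets the side condition of the description; as \<Omega> is open, it
    changes no derivative at points of \<Omega>.\<close>
  define K where "K z w = (if z \<in> \<Omega> \<and> w \<in> \<Omega> then L z w else 0)" for z w
  have "(\<lambda>z. K z \<zeta>) \<in> bergman_space \<Omega> \<and> bergman_inner \<Omega> f (\<lambda>z. K z \<zeta>) = bergman_inner \<Omega> f (\<lambda>z. L z \<zeta>)"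
    if \<zeta>: "\<zeta> \<in> \<Omega>" for \<zeta> f
  proof
    have M: "(\<lambda>z. L z \<zeta>) \<in> bergman_space \<Omega>" using L \<zeta> by (simp add: is_bergman_kernel_def)
    have "cdiff (\<lambda>z. K z \<zeta>) z" if z: "z \<in> \<Omega>" for z
    proof -
      obtain D where D: "((\<lambda>z. L z \<zeta>) has_derivative D) (at z)" "\<And>c v. D (c *s v) = c * D v"
        using M z unfolding bergman_space_def holomorphic_on_vec_iff cdiff_def by blast
      have "((\<lambda>z. K z \<zeta>) has_derivative D) (at z)"
        by (rule has_derivative_transform_within_open[OF D(1) assms z]) (simp add: K_def \<zeta>)
      then show ?thesis using D(2) unfolding cdiff_def by blast
    qed
    then show "(\<lambda>z. K z \<zeta>) \<in> bergman_space \<Omega>"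
      using M \<zeta> unfolding bergman_space_def holomorphic_on_vec_iff
      by (auto simp: K_def cong: set_integrable_cong)
    show "bergman_inner \<Omega> f (\<lambda>z. K z \<zeta>) = bergman_inner \<Omega> f (\<lambda>z. L z \<zeta>)"
      unfolding bergman_inner_def using \<zeta> assms
      by (intro set_lebesgue_integral_cong) (auto simp: K_def)
  qed
  then have "?P K" using L by (auto simp: is_bergman_kernel_def K_def)
  moreover have "K' = K" if "?P K'" for K'
    using is_bergman_kernel_unique[of \<Omega> K' K] that \<open>?P K\<close> by (metis ext)
  ultimately have "?P (THE K. ?P K)" by (rule theI)
  then show ?thesis unfolding bergman_kernel_def by blast
qed

text \<open>Only one second argument is known explicitly, so \<open>k\<close> is patched into the
  existing kernel at \<zeta>; uniqueness then compares the two.\<close>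

lemma bergman_kernel_eqI:
  fixes \<Omega> :: "(complex ^ 'n) set"
  assumes \<Omega>: "open \<Omega>" and k: "k \<in> bergman_space \<Omega>" and \<zeta>: "\<zeta> \<in> \<Omega>" and z: "z \<in> \<Omega>"
    and rep: "\<And>f. f \<in> bergman_space \<Omega> \<Longrightarrow> f \<zeta> = bergman_inner \<Omega> f k"
  shows "bergman_kernel \<Omega> z \<zeta> = k z"
proof -
  have "is_bergman_kernel \<Omega> (\<lambda>z w. if w = \<zeta> then k z else bergman_kernel \<Omega> z w)"
    unfolding is_bergman_kernel_def
  proof
    fix w assume w: "w \<in> \<Omega>"
    show "(\<lambda>z. if w = \<zeta> then k z else bergman_kernel \<Omega> z w) \<in> bergman_space \<Omega> \<and>
      (\<forall>f\<in>bergman_space \<Omega>. f w = bergman_inner \<Omega> f (\<lambda>z. if w = \<zeta> then k z else bergman_kernel \<Omega> z w))"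
    proof (cases "w = \<zeta>")
      case True
      then show ?thesis using k rep by simp
    next
      case False
      then show ?thesis
        using is_bergman_kernel_bergman_kernel[OF \<Omega>] w by (simp add: is_bergman_kernel_def)
    qed
  qed
  from is_bergman_kernel_unique[OF is_bergman_kernel_bergman_kernel[OF \<Omega>] this z \<zeta>] show ?thesis by simp
qed

theorem corollary3: "\<not> lu_qi_keng tetrablock"
proof -
  \<comment> \<open>The choice makes 3 (1 - s^2)^2 = 4 s^2; since \<open>axis_kernel\<close> depends
    on w^2, which has to be \<open>s\<close>, a second root is taken.\<close>
  define s where "s = 1 / sqrt (3 :: real)"
  define w where "w = sqrt s"
  have s: "s > 0" "s < 1" "s\<^sup>2 = 1 / 3" by (simp_all add: s_def power_divide)
  have w: "w \<noteq> 0" "\<bar>w\<bar> < 1" "w\<^sup>2 = s" using s by (simp_all add: w_def)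
  have W: "(complex_of_real w)\<^sup>2 = of_real s" using w(3) by (simp flip: of_real_power)
  have ss: "complex_of_real s * of_real s = 1 / 3"
    using arg_cong[OF s(3), of complex_of_real] by (simp add: power2_eq_square)
  define x y :: "complex ^ 3" where "x = vector [0, 0, of_real s]" and "y = vector [0, 0, - (of_real w)\<^sup>2]"
  \<comment> \<open>For (0, 0, s) and (0, 0, -s) the second tetrablock inequality reads 2 s < 1 +
    s^2 = 4/3.\<close>
  have "s < 2 / 3"
  proof (rule power2_less_imp_less)
    show "s\<^sup>2 < (2 / 3)\<^sup>2" by (simp add: s(3) power_divide)
  qed simp
  then have xy: "x \<in> tetrablock" "y \<in> tetrablock"
    using s by (simp_all add: tetrablock_iff x_def y_def W)
  define V where "V = complex_of_real (measure lborel R_II)"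
  have V: "V \<noteq> 0" using R_II_measure(2) by (simp add: V_def)
  define k where "k z = (1 / V) * axis_kernel w z" for z
  have "bergman_kernel tetrablock x y = k x"
  proof (rule bergman_kernel_eqI[OF open_tetrablock _ xy(2) xy(1)])
    show "k \<in> bergman_space tetrablock"
      unfolding k_def[abs_def]
      using bergman_space_lincomb[OF open_tetrablock axis_kernel_reproducing(1) axis_kernel_reproducing(1), of w w "1 / V" 0] w
      by simp
    fix f assume f: "f \<in> bergman_space tetrablock"
    have "bergman_inner tetrablock f k = (1 / V) * bergman_inner tetrablock f (axis_kernel w)"
      unfolding bergman_inner_def k_def[abs_def] by (subst set_integral_mult_right[symmetric]) (simp add: V_def mult.left_commute)
    also have "\<dots> = f y"
      using axis_kernel_reproducing(2)[OF w(1,2) f] V by (simp add: y_def V_def)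
    finally show "f y = bergman_inner tetrablock f k" ..
  qed
  \<comment> \<open>The numerator vanishes, so the zero does not come from division by 0.\<close>
  also have "k x = 0"
  proof -
    have "3 * (1 - complex_of_real s * of_real s)\<^sup>2 + 4 * of_real s * (0 * 0 - of_real s) = 0"
      by (simp add: ss mult.assoc power2_eq_square[of "2 / 3"])
    then show ?thesis unfolding k_def axis_kernel_def x_def W vector_3 by simp
  qed
  finally show ?thesis using xy by (auto simp: lu_qi_keng_def)
qed

end
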